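(* Assume that for every $n\in\mathbb N$ there are constants $0<m_{2n}\le M_{2n}$ and $M_{2n+1}>0$ such that for all $v\in H$: i) $m_{2n}\|v\|_{W_1}^2\le\|B_1^*(t)v\|_{U_1}^2\le M_{2n}\|v\|_{W_1}^2$ for $t\in I_{2n}$; ii) $\|B_2^*(t)v\|_{U_2}^2\le M_{2n+1}\|v\|_{W_2}^2$ for $t\in I_{2n+1}$; and assume that $T_{2n+1}\le\tau$ for all $n\in\mathbb N$. Assume that there is a time $\overline T>0$ such that for every $T>\overline T$ there is a constant $c=c(T)>0$, independent of the initial data, such that $$\frac12\left(\|w_0\|_V^2+\|w_1\|_H^2\right)\le c\int_0^T\|w_t(s)\|_{W_1}^2\,ds$$ for every weak solution $w$ of $w_{tt}+Aw=0$, $t>0$, $w(0)=w_0$, $w_t(0)=w_1$ with $(w_0,w_1)\in V\times H$. Assume that $T^*:=\inf_nT_{2n}$ satisfies $T^*>\overline T$ and $T^*\ge\tau$. If $$\sum_{n=0}^\infty M_{2n+1}T_{2n+1}<+\infty\qquad\text{and}\qquad\sum_{n=0}^\infty\frac{m_{2n}}{1+4C_1^2T_{2n}^2M_{2n}^2}=+\infty,$$ then the delayed problem is asymptotically stable, that is, every solution $u$ of the delayed problem satisfies $E_S(u,t)\to0$ as $t\to+\infty$.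
   Context: $\mathbb N=\{0,1,2,\dots\}$. $H$ is a real Hilbert space; $A:\mathcal D(A)\to H$ is a positive self-adjoint operator with compact inverse; $V=\mathcal D(A^{1/2})$ with $\|v\|_V=\|A^{1/2}v\|_H$; $V'$ is the dual of $V$ with pivot space $H$. $U_1,U_2$ are real Hilbert spaces, identified with their duals; $\tau>0$ is fixed. $0=t_0<t_1<t_2<\cdots$ is a sequence, $I_n=[t_n,t_{n+1})$, $T_n=t_{n+1}-t_n$, and $T_{2n}\ge\tau$ for all $n$. $B_1(t)\in\mathcal L(U_1,H)$, $B_2(t)\in\mathcal L(U_2,H)$ satisfy, for all $n$: $B_2(t)=0$ for $t\in I_{2n}$, $B_1(t)=0$ for $t\in I_{2n+1}$, $B_1\in C^1([t_{2n},t_{2n+1}];\mathcal L(U_1,H))$ and $B_2\in C([t_{2n+1},t_{2n+2}];\mathcal L(U_2,H))$ (continuity up to the right endpoint is understood as existence of an extension from the half-open interval). $W_1,W_2$ are Hilbert spaces in which $H$ is continuously embedded, with $C_i>0$ such that $\|v\|_{W_i}^2\le C_i\|v\|_H^2$ for all $v\in H$, $i=1,2$. Delayed problem: $$u_{tt}(t)+Au(t)+B_1(t)B_1^*(t)u_t(t)+B_2(t)B_2^*(t)u_t(t-\tau)=0,\ t>0,\qquad u(0)=u_0\in V,\ u_t(0)=u_1\in H.$$ The delay term is $0$ whenever $B_2(t)=0$, in particular on $[0,\tau)$, so no history data are needed. A solution is a mild (equivalently weak, with the equation holding in $V'$) solution $u\in C([0,\infty);V)\cap C^1([0,\infty);H)$.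 Standard energy: $E_S(t)=E_S(u,t):=\frac12\left(\|u(t)\|_V^2+\|u_t(t)\|_H^2\right)$. *)

theory Defs
  imports "HOL-Analysis.Analysis"
begin

text \<open>An unbounded operator on a Hilbert space is a domain \<open>D\<close> together with a total
  function \<open>A\<close>; the values of \<open>A\<close> outside \<open>D\<close> are irrelevant.\<close>

definition densely_defined_linear :: "'h::real_inner set \<Rightarrow> ('h \<Rightarrow> 'h) \<Rightarrow> bool" where
  "densely_defined_linear D A \<longleftrightarrow>
     subspace D \<and> closure D = UNIV \<and>
     (\<forall>x\<in>D. \<forall>y\<in>D. A (x + y) = A x + A y) \<and>
     (\<forall>c. \<forall>x\<in>D. A (c *\<^sub>R x) = c *\<^sub>R A x)"

definition adjoint_graph :: "'h::real_inner set \<Rightarrow> ('h \<Rightarrow> 'h) \<Rightarrow> ('h \<times> 'h) set" where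
  "adjoint_graph D A = {(y, z). \<forall>x\<in>D. A x \<bullet> y = x \<bullet> z}"

definition selfadjoint_operator :: "'h::real_inner set \<Rightarrow> ('h \<Rightarrow> 'h) \<Rightarrow> bool" where
  "selfadjoint_operator D A \<longleftrightarrow>
     densely_defined_linear D A \<and> adjoint_graph D A = (\<lambda>x. (x, A x)) ` D"

text \<open>For a self-adjoint operator that is injective on its domain, nonnegativity already implies
  \<open>A x \<bullet> x > 0\<close> for \<open>x \<noteq> 0\<close>.\<close>

definition positive_operator :: "'h::real_inner set \<Rightarrow> ('h \<Rightarrow> 'h) \<Rightarrow> bool" where
  "positive_operator D A \<longleftrightarrow> (\<forall>x\<in>D. 0 \<le> A x \<bullet> x)"

definition compact_operator :: "('a::real_normed_vector \<Rightarrow> 'b::real_normed_vector) \<Rightarrow> bool" where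
  "compact_operator K \<longleftrightarrow> bounded_linear K \<and> compact (closure (K ` cball 0 1))"

definition has_compact_inverse :: "'h::real_inner set \<Rightarrow> ('h \<Rightarrow> 'h) \<Rightarrow> bool" where
  "has_compact_inverse D A \<longleftrightarrow> bij_betw A D UNIV \<and> compact_operator (inv_into D A)"

text \<open>\<open>(V, S)\<close> is the square root \<open>A\<^sup>1\<^sup>/\<^sup>2\<close> of \<open>(D, A)\<close>: the (unique) positive self-adjoint operator
  with \<open>S S = A\<close>, domains included. In particular \<open>V\<close> is the domain of \<open>A\<^sup>1\<^sup>/\<^sup>2\<close>.\<close>

definition is_sqrt_operator ::
  "'h::real_inner set \<Rightarrow> ('h \<Rightarrow> 'h) \<Rightarrow> 'h set \<Rightarrow> ('h \<Rightarrow> 'h) \<Rightarrow> bool" where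
  "is_sqrt_operator V S D A \<longleftrightarrow>
     selfadjoint_operator V S \<and> positive_operator V S \<and>
     D = {x \<in> V. S x \<in> V} \<and> (\<forall>x\<in>D. S (S x) = A x)"

definition norm_V :: "('h::real_inner \<Rightarrow> 'h) \<Rightarrow> 'h \<Rightarrow> real" where
  "norm_V S v = norm (S v)"

text \<open>Time derivative on \<open>[0,\<infinity>)\<close>, one-sided at \<open>0\<close>.\<close>

definition dt :: "(real \<Rightarrow> 'h::real_normed_vector) \<Rightarrow> real \<Rightarrow> 'h" where
  "dt u t = vector_derivative u (at t within {0..})"

definition C0_V :: "'h::real_inner set \<Rightarrow> ('h \<Rightarrow> 'h) \<Rightarrow> (real \<Rightarrow> 'h) \<Rightarrow> bool" where
  "C0_V V S u \<longleftrightarrow>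
     (\<forall>t\<ge>0. u t \<in> V) \<and>
     (\<forall>t\<ge>0. ((\<lambda>s. norm_V S (u s - u t)) \<longlongrightarrow> 0) (at t within {0..}))"

definition C1_H :: "(real \<Rightarrow> 'h::real_normed_vector) \<Rightarrow> bool" where
  "C1_H u \<longleftrightarrow>
     (\<forall>t\<ge>0. (u has_vector_derivative dt u t) (at t within {0..})) \<and> continuous_on {0..} (dt u)"

text \<open>Weak solutions of \<open>u\<^sub>t\<^sub>t + A u + F = 0\<close>, \<open>u(0) = u0\<close>, \<open>u\<^sub>t(0) = u1\<close>. The equation is an identity
  in \<open>V'\<close>, i.e. it is tested with every \<open>v \<in> V\<close>; the pairing of \<open>A u(s) \<in> V'\<close> with \<open>v\<close> is
  \<open>S u(s) \<bullet> S v\<close>, and \<open>H\<close> is the pivot space. It is integrated over \<open>[0,t]\<close> because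
  \<open>F\<close> may jump, so that \<open>u\<^sub>t\<^sub>t(t)\<close> need not exist at every \<open>t\<close>.\<close>

definition weak_solution ::
  "'h::real_inner set \<Rightarrow> ('h \<Rightarrow> 'h) \<Rightarrow> (real \<Rightarrow> 'h) \<Rightarrow> 'h \<Rightarrow> 'h \<Rightarrow> (real \<Rightarrow> 'h) \<Rightarrow> bool" where
  "weak_solution V S F u0 u1 u \<longleftrightarrow>
     C0_V V S u \<and> C1_H u \<and> u 0 = u0 \<and> dt u 0 = u1 \<and>
     (\<forall>v\<in>V. \<forall>t\<ge>0.
        ((\<lambda>s. S (u s) \<bullet> S v + F s \<bullet> v) has_integral (u1 \<bullet> v - dt u t \<bullet> v)) {0..t})"

definition wave_solution ::
  "'h::real_inner set \<Rightarrow> ('h \<Rightarrow> 'h) \<Rightarrow> 'h \<Rightarrow> 'h \<Rightarrow> (real \<Rightarrow> 'h) \<Rightarrow> bool" where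
  "wave_solution V S w0 w1 w \<longleftrightarrow> weak_solution V S (\<lambda>_. 0) w0 w1 w"

definition adj :: "('u::real_inner \<Rightarrow>\<^sub>L 'h::real_inner) \<Rightarrow> 'h \<Rightarrow> 'u" where
  "adj B = adjoint (blinfun_apply B)"

text \<open>For \<open>t < \<tau>\<close> the value \<open>dt u (t - \<tau>)\<close> is meaningless, but it is multiplied by \<open>B2 t\<close>, which
  vanishes there in the intended situation.\<close>

definition delayed_solution ::
  "'h::real_inner set \<Rightarrow> ('h \<Rightarrow> 'h) \<Rightarrow> (real \<Rightarrow> 'u1::real_inner \<Rightarrow>\<^sub>L 'h) \<Rightarrow>
   (real \<Rightarrow> 'u2::real_inner \<Rightarrow>\<^sub>L 'h) \<Rightarrow> real \<Rightarrow> 'h \<Rightarrow> 'h \<Rightarrow> (real \<Rightarrow> 'h) \<Rightarrow> bool" where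
  "delayed_solution V S B1 B2 \<tau> u0 u1 u \<longleftrightarrow>
     weak_solution V S
       (\<lambda>t. blinfun_apply (B1 t) (adj (B1 t) (dt u t)) +
            blinfun_apply (B2 t) (adj (B2 t) (dt u (t - \<tau>))))
       u0 u1 u"

definition E_S :: "('h::real_inner \<Rightarrow> 'h) \<Rightarrow> (real \<Rightarrow> 'h) \<Rightarrow> real \<Rightarrow> real" where
  "E_S S u t = 1/2 * ((norm_V S (u t))\<^sup>2 + (norm (dt u t))\<^sup>2)"

definition slot :: "(nat \<Rightarrow> real) \<Rightarrow> nat \<Rightarrow> real set" where
  "slot tn n = {tn n..<tn (Suc n)}"

definition slot_len :: "(nat \<Rightarrow> real) \<Rightarrow> nat \<Rightarrow> real" where
  "slot_len tn n = tn (Suc n) - tn n"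

text \<open>Regularity of a function given on \<open>[a,b)\<close> up to the right endpoint \<open>b\<close>, where the function
  itself may jump.\<close>

definition C0_ext :: "real \<Rightarrow> real \<Rightarrow> (real \<Rightarrow> 'b::real_normed_vector) \<Rightarrow> bool" where
  "C0_ext a b B \<longleftrightarrow> (\<exists>E. continuous_on {a..b} E \<and> (\<forall>t\<in>{a..<b}. E t = B t))"

definition C1_ext :: "real \<Rightarrow> real \<Rightarrow> (real \<Rightarrow> 'b::real_normed_vector) \<Rightarrow> bool" where
  "C1_ext a b B \<longleftrightarrow>
     (\<exists>E E'. (\<forall>t\<in>{a..b}. (E has_vector_derivative E' t) (at t within {a..b})) \<and>
             continuous_on {a..b} E' \<and> (\<forall>t\<in>{a..<b}. E t = B t))"

text \<open>A Hilbert space \<open>W\<close> in which \<open>H\<close> is continuously embedded is modelled by an injective linear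
  map \<open>j : H \<rightarrow> W\<close>; \<open>C\<close> is the constant of the embedding.\<close>

definition continuous_embedding :: "('h::real_normed_vector \<Rightarrow> 'w::real_normed_vector) \<Rightarrow> real \<Rightarrow> bool" where
  "continuous_embedding j C \<longleftrightarrow>
     linear j \<and> inj j \<and> 0 < C \<and> (\<forall>v. (norm (j v))\<^sup>2 \<le> C * (norm v)\<^sup>2)"

definition observable ::
  "'h::real_inner set \<Rightarrow> ('h \<Rightarrow> 'h) \<Rightarrow> ('h \<Rightarrow> 'w::real_normed_vector) \<Rightarrow> real \<Rightarrow> bool" where
  "observable V S j T \<longleftrightarrow>
     (\<exists>c>0. \<forall>w0\<in>V. \<forall>w1 w. wave_solution V S w0 w1 w \<longrightarrow>
        1/2 * ((norm_V S w0)\<^sup>2 + (norm w1)\<^sup>2) \<le> c * integral {0..T} (\<lambda>s. (norm (j (dt w s)))\<^sup>2))"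

end

theory Submission
  imports Defs
begin

text \<open>On \<open>I\<^sub>2\<^sub>n\<close> the energy only loses the damping term. Comparing \<open>u\<close> with an undamped wave with
  nearly the same data and using observability on a fixed time \<open>T\<^sub>0\<close> between \<open>Tbar\<close> and \<open>inf T\<^sub>2\<^sub>n\<close>
  (so that the observability constant \<open>c\<close> does not depend on \<open>n\<close>), this loss is at least \<open>\<kappa>\<^sub>n E(t\<^sub>2\<^sub>n)\<close>,
  where \<open>\<kappa>\<^sub>n\<close> is the general term of the divergent series divided by \<open>2c\<close>. On \<open>I\<^sub>2\<^sub>n\<^sub>+\<^sub>1\<close> the delayed
  velocity was measured during \<open>I\<^sub>2\<^sub>n\<close>, where the energy was at most \<open>E(t\<^sub>2\<^sub>n)\<close>, so the energy grows
  by at most \<open>b\<^sub>n E(t\<^sub>2\<^sub>n)\<close> with \<open>\<Sum>b\<^sub>n < \<infinity>\<close>. Hence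
  \<open>E(t\<^sub>2\<^sub>N) \<le> E(0) exp (\<Sum>b\<^sub>n - \<Sum>\<kappa>\<^sub>n) \<rightarrow> 0\<close>.\<close>

subsection \<open>Hilbert space preliminaries\<close>

text \<open>The term \<open>1 + 4 * C1^2 * T^2 * M^2\<close> of the series comes from the difference
  \<open>z\<close> of the damped solution and the wave. With J the energy lost and f = B1* u_t,
  \<open>z\<close> has almost zero data and is driven by -B1 f. Young's inequality, weighted so that
  the supremum y of the norm of z_t is absorbed, gives y^2 <= 4 T M C1 J up to the data error. The
  W1-norm of w_t is controlled by those of u_t (through f and m) and of z_t (through y), so
  observability bounds the energy by 2 c (1/m + 4 C1^2 T^2 M) J. Pulling out 1/m leaves M m, which
  is at most M^2.

  Regularity is the main obstacle: u_t lies only in H and cannot be used as a test function, and the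
  operators may jump at the ends of the intervals. Estimates on the half-open intervals are
  therefore carried to the right endpoint by continuity of the energy.

  The delay term pairs a past velocity with the present one. It is linear in the square root of the
  present energy, so a quadratic inequality takes the place of a Gronwall argument.\<close>

text \<open>The representing vector minimises \<open>norm x ^ 2 - 2 * f x\<close> over
  \<open>N\<close>: the parallelogram law makes a minimising sequence Cauchy, and the first
  variation at the limit is the claim. \<open>N = UNIV\<close> gives Riesz representation;
  \<open>f\<close> an inner product with \<open>p\<close> gives the orthogonal projection of
  \<open>p\<close> onto \<open>N\<close>.\<close>

lemma riesz_closed_subspace:
  fixes f :: "'a::{real_inner, complete_space} \<Rightarrow> real"
  assumes "closed N" and N: "subspace N" and f: "bounded_linear f"
  shows "\<exists>x\<in>N. \<forall>y\<in>N. f y = x \<bullet> y"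
proof -
  interpret f: bounded_linear f by (rule f)
  obtain C where C: "\<And>x. norm (f x) \<le> norm x * C" using f.bounded by blast
  define \<Phi> where "\<Phi> x = (norm x)\<^sup>2 - 2 * f x" for x
  have low: "- C\<^sup>2 \<le> \<Phi> x" for x
  proof -
    have "f x \<le> norm x * C" using C[of x] by (simp add: abs_le_iff)
    moreover have "0 \<le> (norm x - C)\<^sup>2" by simp
    ultimately show ?thesis by (simp add: \<Phi>_def power2_diff algebra_simps)
  qed
  have ne: "0 \<in> N" using N by (rule subspace_0)
  define d where "d = (INF x\<in>N. \<Phi> x)"
  have bdd: "bdd_below (\<Phi> ` N)" using low by (auto intro!: bdd_belowI)
  have d_le: "d \<le> \<Phi> x" if "x \<in> N" for x
    unfolding d_def using bdd that by (rule cINF_lower)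
  have "\<exists>x\<in>N. \<Phi> x < d + 1 / Suc k" for k :: nat
  proof -
    have "d < d + 1 / Suc k" by simp
    thus ?thesis unfolding d_def using bdd ne by (subst (asm) cINF_less_iff) auto
  qed
  then obtain X where X: "\<And>k. X k \<in> N" "\<And>k. \<Phi> (X k) < d + 1 / Suc k" by metis
  have par: "(norm (x - y))\<^sup>2 \<le> 2 * \<Phi> x + 2 * \<Phi> y - 4 * d" if "x \<in> N" "y \<in> N" for x y
  proof -
    have "(1/2) *\<^sub>R (x + y) \<in> N" using that N by (intro subspace_scale subspace_add)
    hence "d \<le> \<Phi> ((1/2) *\<^sub>R (x + y))" by (rule d_le)
    also have "\<dots> = \<Phi> x / 2 + \<Phi> y / 2 - (norm (x - y))\<^sup>2 / 4"
      by (simp add: \<Phi>_def f.add f.scaleR power2_norm_eq_inner inner_add inner_diff inner_commute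
            field_simps)
    finally show ?thesis by simp
  qed
  have "Cauchy X"
  proof (rule metric_CauchyI)
    fix e :: real assume e: "0 < e"
    obtain n :: nat where n: "4 / e\<^sup>2 < n" using reals_Archimedean2 by blast
    have n0: "0 < real n" using n e by (smt (verit) divide_pos_pos zero_less_power)
    have b: "\<Phi> (X k) < d + e\<^sup>2 / 4" if "k \<ge> n" for k
    proof -
      have "1 / Suc k \<le> 1 / real n" using that n0 by (intro divide_left_mono) auto
      also have "\<dots> < e\<^sup>2 / 4" using n n0 e by (simp add: field_simps)
      finally show ?thesis using X(2)[of k] by linarith
    qed
    show "\<exists>N. \<forall>m\<ge>N. \<forall>k\<ge>N. dist (X m) (X k) < e"
    proof (intro exI allI impI)
      fix m k assume "m \<ge> n" "k \<ge> n"
      hence "(norm (X m - X k))\<^sup>2 < e\<^sup>2" using par[OF X(1) X(1), of m k] b[of m] b[of k] by linarith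
      thus "dist (X m) (X k) < e" using e by (simp add: dist_norm power_less_imp_less_base)
    qed
  qed
  then obtain x where x: "X \<longlonglongrightarrow> x" using Cauchy_convergent_iff convergent_def by blast
  have xN: "x \<in> N" using \<open>closed N\<close> X(1) x by (metis closed_sequentially)
  have "\<Phi> x \<le> d"
  proof (rule LIMSEQ_le)
    show "(\<lambda>k. \<Phi> (X k)) \<longlonglongrightarrow> \<Phi> x" unfolding \<Phi>_def by (intro tendsto_intros x f.tendsto)
    show "(\<lambda>k. d + 1 / Suc k) \<longlonglongrightarrow> d"
      using tendsto_add[OF tendsto_const[of d] lim_inverse_n'[THEN LIMSEQ_Suc]] by simp
    show "\<exists>N. \<forall>k\<ge>N. \<Phi> (X k) \<le> d + 1 / real (Suc k)" using X(2) less_imp_le by blast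
  qed
  have "f y = x \<bullet> y" if y: "y \<in> N" for y
  proof -
    define g where "g = x \<bullet> y - f y"
    have q: "0 \<le> t\<^sup>2 * (norm y)\<^sup>2 + 2 * t * g" for t
    proof -
      have "x + t *\<^sub>R y \<in> N" using xN y N by (intro subspace_scale subspace_add)
      hence "\<Phi> x \<le> \<Phi> (x + t *\<^sub>R y)" using d_le \<open>\<Phi> x \<le> d\<close> by fastforce
      also have "\<dots> = \<Phi> x + t\<^sup>2 * (norm y)\<^sup>2 + 2 * t * g"
        unfolding \<Phi>_def g_def f.add f.scaleR power2_norm_eq_inner
        by (simp add: inner_add inner_commute power2_eq_square algebra_simps)
      finally show ?thesis by simp
    qed
    have "g = 0"
    proof (cases "y = 0")
      case True thus ?thesis by (simp add: g_def f.zero)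
    next
      case False
      define n where "n = (norm y)\<^sup>2"
      have n: "0 < n" using False by (simp add: n_def)
      have "(- g / n)\<^sup>2 * n + 2 * (- g / n) * g = - (g\<^sup>2 / n)"
        using n by (simp add: field_simps power2_eq_square)
      hence "g\<^sup>2 / n \<le> 0" using q[of "- g / n"] unfolding n_def by linarith
      thus ?thesis using n by (simp add: divide_le_0_iff)
    qed
    thus ?thesis by (simp add: g_def)
  qed
  thus ?thesis using xN by blast
qed

text \<open>\<open>adjoint\<close> is a choice among maps with the adjoint property, so this
  identity becomes available only once Riesz representation shows that such a map exists.\<close>

lemma inner_adj:
  fixes B :: "'a::{real_inner, complete_space} \<Rightarrow>\<^sub>L 'b::real_inner"
  shows "blinfun_apply B x \<bullet> y = x \<bullet> adj B y"
proof -
  have "\<exists>z. \<forall>x. blinfun_apply B x \<bullet> y = x \<bullet> z" for y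
  proof -
    have "bounded_linear (\<lambda>x. blinfun_apply B x \<bullet> y)"
      by (intro bounded_linear_inner_left_comp blinfun.bounded_linear_right)
    from riesz_closed_subspace[OF closed_UNIV subspace_UNIV this]
    show ?thesis by (auto simp: inner_commute)
  qed
  hence "\<exists>f'. \<forall>x y. blinfun_apply B x \<bullet> y = x \<bullet> f' y" by metis
  thus ?thesis unfolding adj_def adjoint_def by (rule someI2_ex) simp
qed

lemma adj_eqI:
  fixes B :: "'a::{real_inner, complete_space} \<Rightarrow>\<^sub>L 'b::real_inner"
  assumes "\<And>x. blinfun_apply B x \<bullet> y = x \<bullet> z"
  shows "adj B y = z"
proof -
  have "\<forall>x. x \<bullet> adj B y = x \<bullet> z" using assms by (simp flip: inner_adj)
  thus ?thesis by (simp only: vector_eq_ldot)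
qed

text \<open>Bilinearity makes the adjoint jointly continuous in operator and vector, as needed for
  B(t)* u_t(t). The bound follows from testing B(B* y) with y.\<close>

lemma bounded_bilinear_adj:
  "bounded_bilinear (adj :: ('a::{real_inner, complete_space} \<Rightarrow>\<^sub>L 'b::real_inner) \<Rightarrow> 'b \<Rightarrow> 'a)"
proof
  fix B B' :: "'a \<Rightarrow>\<^sub>L 'b" and y y' :: 'b and r :: real
  show "adj (B + B') y = adj B y + adj B' y"
    by (rule adj_eqI) (simp add: blinfun.add_left inner_add inner_adj)
  show "adj B (y + y') = adj B y + adj B y'"
    by (rule adj_eqI) (simp add: inner_add inner_adj)
  show "adj (r *\<^sub>R B) y = r *\<^sub>R adj B y"
    by (rule adj_eqI) (simp add: blinfun.scaleR_left inner_adj)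
  show "adj B (r *\<^sub>R y) = r *\<^sub>R adj B y"
    by (rule adj_eqI) (simp add: inner_adj)
  show "\<exists>K. \<forall>(B :: 'a \<Rightarrow>\<^sub>L 'b) y. norm (adj B y) \<le> norm B * norm y * K"
  proof (intro exI[of _ 1] allI)
    fix B :: "'a \<Rightarrow>\<^sub>L 'b" and y
    have "norm (adj B y) * norm (adj B y) = blinfun_apply B (adj B y) \<bullet> y"
      by (simp add: inner_adj flip: power2_norm_eq_inner power2_eq_square)
    also have "\<dots> \<le> norm (blinfun_apply B (adj B y)) * norm y" by (rule norm_cauchy_schwarz)
    also have "\<dots> \<le> (norm B * norm (adj B y)) * norm y"
      by (intro mult_right_mono norm_blinfun) auto
    finally have "norm (adj B y) * norm (adj B y) \<le> norm (adj B y) * (norm B * norm y)"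
      by (simp add: algebra_simps)
    thus "norm (adj B y) \<le> norm B * norm y * 1"
      by (cases "adj B y = 0") auto
  qed
qed

text \<open>The difference between a point and its projection onto \<open>closure N\<close> is
  orthogonal to \<open>N\<close>, hence zero.\<close>

lemma dense_subspace:
  fixes N :: "'a::{real_inner, complete_space} set"
  assumes N: "subspace N" and triv: "\<And>x. (\<And>y. y \<in> N \<Longrightarrow> x \<bullet> y = 0) \<Longrightarrow> x = 0"
  shows "closure N = UNIV"
proof -
  have "p \<in> closure N" for p
  proof -
    have sc: "subspace (closure N)"
    proof (rule subspaceI)
      show "0 \<in> closure N" using subspace_0[OF N] closure_subset by blast
    next
      fix x y assume "x \<in> closure N" "y \<in> closure N"
      then obtain X Y where "\<And>n. X n \<in> N" "X \<longlonglongrightarrow> x" "\<And>n. Y n \<in> N" "Y \<longlonglongrightarrow> y"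
        unfolding closure_sequential by metis
      thus "x + y \<in> closure N" unfolding closure_sequential
        by (intro exI[of _ "\<lambda>n. X n + Y n"]) (auto intro: tendsto_intros subspace_add[OF N])
    next
      fix c x assume "x \<in> closure N"
      then obtain X where "\<And>n. X n \<in> N" "X \<longlonglongrightarrow> x" unfolding closure_sequential by metis
      thus "c *\<^sub>R x \<in> closure N" unfolding closure_sequential
        by (intro exI[of _ "\<lambda>n. c *\<^sub>R X n"]) (auto intro: tendsto_intros subspace_scale[OF N])
    qed
    obtain x where x: "x \<in> closure N" "\<And>y. y \<in> closure N \<Longrightarrow> p \<bullet> y = x \<bullet> y"
      using riesz_closed_subspace[OF closed_closure sc bounded_linear_inner_right[of p]] by blast
    have "p - x = 0" using x(2) closure_subset by (intro triv) (auto simp: inner_diff)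
    thus ?thesis using x by simp
  qed
  thus ?thesis by blast
qed

text \<open>The type is not of sort \<open>banach\<close>, so vector-valued integrals of continuous functions are not
  available from the library; the antiderivative is obtained weakly, by Riesz representation.\<close>

lemma antiderivative_exists:
  fixes q :: "real \<Rightarrow> 'a::{real_inner, complete_space}"
  assumes q: "continuous_on {a..b} q"
  shows "\<exists>Q. \<forall>t\<in>{a..b}. (Q has_vector_derivative q t) (at t within {a..b})"
proof -
  obtain C where C: "\<And>t. t \<in> {a..b} \<Longrightarrow> norm (q t) \<le> C"
    using compact_continuous_image[OF q compact_Icc, THEN compact_imp_bounded]
    unfolding bounded_iff by blast
  have "\<exists>z. \<forall>x. integral {a..t} (\<lambda>r. q r \<bullet> x) = z \<bullet> x" if t: "t \<in> {a..b}" for t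
  proof -
    have qt: "continuous_on {a..t} q" using q t by (auto intro: continuous_on_subset)
    have int: "(\<lambda>r. q r \<bullet> x) integrable_on {a..t}" for x
      by (intro integrable_continuous_real continuous_intros qt)
    have "bounded_linear (\<lambda>x. integral {a..t} (\<lambda>r. q r \<bullet> x))"
    proof (rule bounded_linear_intro)
      fix x y :: 'a and c :: real
      show "integral {a..t} (\<lambda>r. q r \<bullet> (x + y)) = integral {a..t} (\<lambda>r. q r \<bullet> x) + integral {a..t} (\<lambda>r. q r \<bullet> y)"
        by (simp add: inner_add_right Henstock_Kurzweil_Integration.integral_add int)
      show "integral {a..t} (\<lambda>r. q r \<bullet> (c *\<^sub>R x)) = c *\<^sub>R integral {a..t} (\<lambda>r. q r \<bullet> x)"
        by simp
      have "norm (integral {a..t} (\<lambda>r. q r \<bullet> x)) \<le> C * norm x * (t - a)"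
      proof (rule integral_bound)
        fix r assume "r \<in> {a..t}"
        hence "norm (q r) \<le> C" using C t by auto
        thus "norm (q r \<bullet> x) \<le> C * norm x" 
          using Cauchy_Schwarz_ineq2[of "q r" x] by (simp add: order_trans mult_right_mono)
      qed (use t in \<open>auto intro!: continuous_intros qt\<close>)
      thus "norm (integral {a..t} (\<lambda>r. q r \<bullet> x)) \<le> norm x * (C * (t - a))"
        by (simp add: algebra_simps)
    qed
    from riesz_closed_subspace[OF closed_UNIV subspace_UNIV this] show ?thesis by blast
  qed
  then obtain Q where Q: "\<And>t x. t \<in> {a..b} \<Longrightarrow> integral {a..t} (\<lambda>r. q r \<bullet> x) = Q t \<bullet> x" by metis
  have Qd: "((\<lambda>r. Q r \<bullet> x) has_vector_derivative q t \<bullet> x) (at t within {a..b})"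
    if t: "t \<in> {a..b}" for t x
    by (rule has_vector_derivative_transform[OF t _ integral_has_vector_derivative[OF _ t]])
       (auto simp: Q intro!: continuous_intros q)
  have "(Q has_vector_derivative q t) (at t within {a..b})" if t: "t \<in> {a..b}" for t
    unfolding has_vector_derivative_def has_derivative_within_alt
  proof (intro conjI allI impI)
    show "bounded_linear (\<lambda>x. x *\<^sub>R q t)" by (rule bounded_linear_scaleR_left)
    fix e :: real assume e: "0 < e"
    obtain d where d: "d > 0" "\<And>s. s \<in> {a..b} \<Longrightarrow> dist s t < d \<Longrightarrow> dist (q s) (q t) < e"
      using q t e unfolding continuous_on_iff by blast
    show "\<exists>d>0. \<forall>s\<in>{a..b}. norm (s - t) < d \<longrightarrow> norm (Q s - Q t - (s - t) *\<^sub>R q t) \<le> e * norm (s - t)"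
    proof (intro exI[of _ d] conjI d(1) ballI impI)
      fix s assume s: "s \<in> {a..b}" "norm (s - t) < d"
      \<comment> \<open>Only the scalar functions \<open>Q r \<bullet> x\<close> are known to be
        differentiable. Testing the remainder with itself, under a modulus of continuity of
        \<open>q\<close> that does not depend on the test vector, turns the scalar estimate into one
        for the norm.\<close>
      define x where "x = Q s - Q t - (s - t) *\<^sub>R q t"
      have sub: "closed_segment t s \<subseteq> {a..b}"
        using s t by (auto simp: closed_segment_eq_real_ivl)
      have "norm (x \<bullet> x) = norm (Q s \<bullet> x - Q t \<bullet> x - (s - t) *\<^sub>R (q t \<bullet> x))"
        by (simp add: x_def inner_diff_left)
      also have "\<dots> \<le> norm (s - t) * (e * norm x)"
      proof (rule vector_differentiable_bound_linearization[where S = "closed_segment t s" and ?x0.0 = t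
            and f = "\<lambda>r. Q r \<bullet> x" and f' = "\<lambda>r. q r \<bullet> x"])
        fix r assume r: "r \<in> closed_segment t s"
        show "((\<lambda>r. Q r \<bullet> x) has_vector_derivative q r \<bullet> x) (at r within closed_segment t s)"
          using Qd r sub by (meson has_vector_derivative_within_subset subsetD)
        have "dist r t < d" using r s(2) by (auto simp: closed_segment_eq_real_ivl dist_real_def split: if_splits)
        hence "norm (q r - q t) \<le> e" using d(2)[of r] r sub by (auto simp: dist_norm)
        hence "norm (q r - q t) * norm x \<le> e * norm x" by (rule mult_right_mono) simp
        thus "norm (q r \<bullet> x - q t \<bullet> x) \<le> e * norm x"
          using Cauchy_Schwarz_ineq2[of "q r - q t" x] by (simp add: inner_diff_left)
      qed auto
      finally have "norm x * norm x \<le> (e * norm (s - t)) * norm x"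
        by (simp add: algebra_simps flip: power2_norm_eq_inner power2_eq_square)
      thus "norm (Q s - Q t - (s - t) *\<^sub>R q t) \<le> e * norm (s - t)"
        using e unfolding x_def[symmetric] by (cases "x = 0") auto
    qed
  qed
  thus ?thesis by blast
qed

subsection \<open>Energy identity\<close>

lemma difference_quotient_tendsto:
  fixes f :: "real \<Rightarrow> 'a::real_normed_vector"
  assumes f: "(f has_vector_derivative D) (at t within X)"
    and h: "h \<longlonglongrightarrow> 0" "\<And>k. h k \<noteq> 0" "\<And>k. t + h k \<in> X"
  shows "(\<lambda>k. (1 / h k) *\<^sub>R (f (t + h k) - f t)) \<longlonglongrightarrow> D"
proof -
  have "((\<lambda>y. (1 / norm (y - t)) *\<^sub>R (f y - (f t + (y - t) *\<^sub>R D))) \<longlongrightarrow> 0) (at t within X)"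
    using f unfolding has_vector_derivative_def has_derivative_within by blast
  moreover have "filterlim (\<lambda>k. t + h k) (at t within X) sequentially"
    unfolding filterlim_at using h tendsto_add[OF tendsto_const[of t] h(1)] by auto
  ultimately have "((\<lambda>k. (1 / norm (t + h k - t)) *\<^sub>R (f (t + h k) - (f t + (t + h k - t) *\<^sub>R D))) \<longlonglongrightarrow> 0)"
    by (rule filterlim_compose)
  hence "(\<lambda>k. norm ((1 / norm (h k)) *\<^sub>R (f (t + h k) - (f t + h k *\<^sub>R D)))) \<longlonglongrightarrow> 0"
    using tendsto_norm_zero by fastforce
  also have "(\<lambda>k. norm ((1 / norm (h k)) *\<^sub>R (f (t + h k) - (f t + h k *\<^sub>R D)))) =
      (\<lambda>k. norm ((1 / h k) *\<^sub>R (f (t + h k) - f t) - D))"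
  proof
    fix k
    have "(1 / h k) *\<^sub>R (f (t + h k) - f t) - D = (1 / h k) *\<^sub>R (f (t + h k) - (f t + h k *\<^sub>R D))"
      using h(2)[of k] by (simp add: algebra_simps)
    thus "norm ((1 / norm (h k)) *\<^sub>R (f (t + h k) - (f t + h k *\<^sub>R D))) =
      norm ((1 / h k) *\<^sub>R (f (t + h k) - f t) - D)" by simp
  qed
  finally show ?thesis by (simp add: tendsto_norm_zero_iff Lim_null[of _ D])
qed

lemma difference_quotient_bound:
  fixes f :: "real \<Rightarrow> 'a::real_normed_vector"
  assumes f: "\<And>x. x \<in> {a..b} \<Longrightarrow> (f has_vector_derivative f' x) (at x within {a..b})"
    and B: "\<And>x. x \<in> {a..b} \<Longrightarrow> norm (f' x) \<le> B"
    and "t \<in> {a..b}" "t + h \<in> {a..b}" and h: "h > 0"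
  shows "norm ((1 / h) *\<^sub>R (f (t + h) - f t)) \<le> B"
proof -
  have "norm (f (t + h) - f t) \<le> B * norm (t + h - t)"
  proof (rule differentiable_bound[of "{a..b}" f "\<lambda>x y. y *\<^sub>R f' x"])
    fix x assume x: "x \<in> {a..b}"
    show "(f has_derivative (\<lambda>y. y *\<^sub>R f' x)) (at x within {a..b})"
      using f[OF x] by (simp add: has_vector_derivative_def)
    show "onorm (\<lambda>y. y *\<^sub>R f' x) \<le> B"
      using B[OF x] by (intro onorm_le) (simp add: mult.commute[of B] mult_left_mono)
  qed (use assms in auto)
  thus ?thesis using h by (simp only: norm_scaleR) (simp add: field_simps)
qed

lemma has_vector_derivative_shift:
  fixes f :: "real \<Rightarrow> 'a::real_normed_vector"
  assumes "(f has_vector_derivative D) (at (t + h) within X)" and "\<And>s. s \<in> Y \<Longrightarrow> s + h \<in> X"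
  shows "((\<lambda>s. f (s + h)) has_vector_derivative D) (at t within Y)"
proof -
  have "((f \<circ> (\<lambda>s. s + h)) has_vector_derivative 1 *\<^sub>R D) (at t within Y)"
  proof (rule vector_diff_chain_within)
    show "((\<lambda>s. s + h) has_vector_derivative 1) (at t within Y)"
      by (auto intro!: derivative_eq_intros)
    show "(f has_vector_derivative D) (at (t + h) within (\<lambda>s. s + h) ` Y)"
      using assms by (auto intro: has_vector_derivative_within_subset)
  qed
  thus ?thesis by (simp add: o_def)
qed

text \<open>The equation is averaged over \<open>[t, t + h]\<close>: the averaged velocity
  \<open>(u (t + h) - u t) / h\<close> lies in \<open>V\<close> and may be used as a test function; then \<open>h \<rightarrow> 0\<close>.\<close>

lemma energy_identity:
  fixes u p q G :: "real \<Rightarrow> 'h::{real_inner, complete_space}"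
  assumes ab: "a \<le> b"
    and u: "\<And>t. t \<in> {a..b} \<Longrightarrow> (u has_vector_derivative p t) (at t within {a..b})"
    and p: "continuous_on {a..b} p" and q: "continuous_on {a..b} q" and G: "continuous_on {a..b} G"
    and V: "subspace V" and uV: "\<And>t. t \<in> {a..b} \<Longrightarrow> u t \<in> V"
    and Su: "\<And>t. t \<in> {a..b} \<Longrightarrow> q t = S (u t)"
    and Sdiff: "\<And>x y. x \<in> V \<Longrightarrow> y \<in> V \<Longrightarrow> S (x - y) = S x - S y"
    and Sscale: "\<And>c x. x \<in> V \<Longrightarrow> S (c *\<^sub>R x) = c *\<^sub>R S x"
    and weak: "\<And>v t. v \<in> V \<Longrightarrow> t \<in> {a..b} \<Longrightarrow>
      ((\<lambda>r. q r \<bullet> S v + G r \<bullet> v) has_integral (p a \<bullet> v - p t \<bullet> v)) {a..t}"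
  shows "integral {a..b} (\<lambda>r. G r \<bullet> p r) =
    1/2 * ((norm (q a))\<^sup>2 + (norm (p a))\<^sup>2) - 1/2 * ((norm (q b))\<^sup>2 + (norm (p b))\<^sup>2)"
proof -
  define e where "e t = 1/2 * ((norm (q t))\<^sup>2 + (norm (p t))\<^sup>2)" for t
  \<comment> \<open>With antiderivatives of \<open>q\<close> and \<open>G\<close>, their averages
    over [t, t + h] become difference quotients, which are differentiable in t even though
    \<open>q\<close> and \<open>G\<close> are merely continuous.\<close>
  obtain Q where Q: "\<And>t. t \<in> {a..b} \<Longrightarrow> (Q has_vector_derivative q t) (at t within {a..b})"
    using antiderivative_exists[OF q] by blast
  obtain \<Gamma> where \<Gamma>: "\<And>t. t \<in> {a..b} \<Longrightarrow> (\<Gamma> has_vector_derivative G t) (at t within {a..b})"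
    using antiderivative_exists[OF G] by blast
  have weakQ: "p t \<bullet> v - p a \<bullet> v = - ((Q t - Q a) \<bullet> S v + (\<Gamma> t - \<Gamma> a) \<bullet> v)"
    if v: "v \<in> V" and t: "t \<in> {a..b}" for v t
  proof -
    have "((\<lambda>r. q r \<bullet> S v + G r \<bullet> v) has_integral
        (Q t \<bullet> S v + \<Gamma> t \<bullet> v) - (Q a \<bullet> S v + \<Gamma> a \<bullet> v)) {a..t}"
    proof (rule fundamental_theorem_of_calculus)
      fix r assume "r \<in> {a..t}"
      hence r: "r \<in> {a..b}" and sub: "{a..t} \<subseteq> {a..b}" using t by auto
      have "((\<lambda>r. Q r \<bullet> S v + \<Gamma> r \<bullet> v) has_vector_derivative q r \<bullet> S v + G r \<bullet> v) (at r within {a..b})"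
        using Q[OF r] \<Gamma>[OF r]
        by (intro has_vector_derivative_add bounded_linear.has_vector_derivative
            [OF bounded_linear_inner_left])
      thus "((\<lambda>r. Q r \<bullet> S v + \<Gamma> r \<bullet> v) has_vector_derivative q r \<bullet> S v + G r \<bullet> v) (at r within {a..t})"
        using sub by (rule has_vector_derivative_within_subset)
    qed (use t in auto)
    from has_integral_unique[OF this weak[OF v t]] show ?thesis by (simp add: inner_diff_left)
  qed
  have bound: "\<exists>C. \<forall>t\<in>{a..b}. norm (f t) \<le> C" if "continuous_on {a..b} f" for f :: "real \<Rightarrow> 'h"
    using compact_continuous_image[OF that compact_Icc, THEN compact_imp_bounded]
    unfolding bounded_iff by blast
  obtain Cp where Cp: "\<And>t. t \<in> {a..b} \<Longrightarrow> norm (p t) \<le> Cp" using bound[OF p] by blast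
  obtain CG where CG: "\<And>t. t \<in> {a..b} \<Longrightarrow> norm (G t) \<le> CG" using bound[OF G] by blast
  \<comment> \<open>Forward averages need t + h <= b, so the identity is proved on [a, c] with c < b
    first.\<close>
  have inner_c: "integral {a..c} (\<lambda>r. G r \<bullet> p r) = e a - e c" if c: "a \<le> c" "c < b" for c
  proof -
    define h where "h k = (b - c) / real (Suc k)" for k
    have h0: "h \<longlonglongrightarrow> 0" unfolding h_def by (intro LIMSEQ_Suc lim_const_over_n)
    have hp: "0 < h k" for k using c by (simp add: h_def)
    have "h k \<le> (b - c) / 1" for k unfolding h_def using c by (intro divide_left_mono) auto
    hence hb: "t + h k \<in> {a..b}" if "t \<in> {a..c}" for t k
      using that hp[of k] c by (smt (verit) atLeastAtMost_iff div_by_1)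
    have tb: "t \<in> {a..b}" if "t \<in> {a..c}" for t using that c by auto
    define P where "P k t = (1 / h k) *\<^sub>R (u (t + h k) - u t)" for k t
    define R where "R k t = (1 / h k) *\<^sub>R (Q (t + h k) - Q t)" for k t
    define g where "g k t = (1 / h k) *\<^sub>R (\<Gamma> (t + h k) - \<Gamma> t)" for k t
    have Plim: "(\<lambda>k. P k t) \<longlonglongrightarrow> p t" and Rlim: "(\<lambda>k. R k t) \<longlonglongrightarrow> q t"
      and glim: "(\<lambda>k. g k t) \<longlonglongrightarrow> G t" if t: "t \<in> {a..c}" for t
      unfolding P_def R_def g_def
      using u[OF tb[OF t]] Q[OF tb[OF t]] \<Gamma>[OF tb[OF t]] h0 hp hb[OF t]
      by (auto intro!: difference_quotient_tendsto simp: less_imp_neq[THEN not_sym])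
    have hd: "((\<lambda>t. (1 / h k) *\<^sub>R (f (t + h k) - f t)) has_vector_derivative
        (1 / h k) *\<^sub>R (f' (t + h k) - f' t)) (at t within {a..c})"
      if f: "\<And>t. t \<in> {a..b} \<Longrightarrow> (f has_vector_derivative f' t) (at t within {a..b})"
        and t: "t \<in> {a..c}" for f f' :: "real \<Rightarrow> 'h" and k t
    proof -
      have "((\<lambda>t. f (t + h k)) has_vector_derivative f' (t + h k)) (at t within {a..c})"
        using f[OF hb[OF t]] hb by (rule has_vector_derivative_shift)
      moreover have "(f has_vector_derivative f' t) (at t within {a..c})"
        using f[OF tb[OF t]] tb by (auto intro: has_vector_derivative_within_subset)
      ultimately show ?thesis
        by (intro bounded_linear.has_vector_derivative[OF bounded_linear_scaleR_right]
            has_vector_derivative_diff)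
    qed
    \<comment> \<open>\<open>S\<close> applied to the averaged velocity \<open>P\<close> is exactly
      the derivative of the averaged \<open>R\<close>, because \<open>q\<close> is \<open>S\<close>
      of \<open>u\<close>. Hence the left side is the derivative of the averaged energy, and the
      equation is satisfied in the classical sense.\<close>
    have key: "P k t \<bullet> ((1 / h k) *\<^sub>R (p (t + h k) - p t)) + R k t \<bullet> ((1 / h k) *\<^sub>R (q (t + h k) - q t))
        = - (g k t \<bullet> P k t)" if t: "t \<in> {a..c}" for k t
    proof -
      have PV: "P k t \<in> V" unfolding P_def
        by (intro subspace_scale[OF V] subspace_diff[OF V] uV hb[OF t] tb[OF t])
      have "S (P k t) = (1 / h k) *\<^sub>R (q (t + h k) - q t)" unfolding P_def
        using uV hb[OF t] tb[OF t] by (simp add: Sscale Sdiff Su subspace_diff[OF V])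
      moreover have "(p (t + h k) - p t) \<bullet> P k t =
          - ((Q (t + h k) - Q t) \<bullet> S (P k t) + (\<Gamma> (t + h k) - \<Gamma> t) \<bullet> P k t)"
        using weakQ[OF PV hb[OF t, of k]] weakQ[OF PV tb[OF t]] by (simp add: inner_diff_left)
      hence "((1 / h k) *\<^sub>R (p (t + h k) - p t)) \<bullet> P k t = - (R k t \<bullet> S (P k t) + g k t \<bullet> P k t)"
        unfolding R_def g_def by (simp add: algebra_simps flip: add_divide_distrib minus_divide_left)
      ultimately show ?thesis by (simp add: inner_commute)
    qed
    define \<epsilon> where "\<epsilon> k t = 1/2 * (R k t \<bullet> R k t + P k t \<bullet> P k t)" for k t
    have int: "((\<lambda>t. - (g k t \<bullet> P k t)) has_integral \<epsilon> k c - \<epsilon> k a) {a..c}" for k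
    proof (rule fundamental_theorem_of_calculus[OF c(1)])
      fix t assume t: "t \<in> {a..c}"
      have dP: "(P k has_vector_derivative (1 / h k) *\<^sub>R (p (t + h k) - p t)) (at t within {a..c})"
        unfolding P_def using u t by (rule hd)
      have dR: "(R k has_vector_derivative (1 / h k) *\<^sub>R (q (t + h k) - q t)) (at t within {a..c})"
        unfolding R_def using Q t by (rule hd)
      have sq: "((\<lambda>t. f t \<bullet> f t) has_vector_derivative 2 * (f t \<bullet> D)) (at t within {a..c})"
        if "(f has_vector_derivative D) (at t within {a..c})" for f :: "real \<Rightarrow> 'h" and D
        using bounded_bilinear.has_vector_derivative[OF bounded_bilinear_inner that that]
        by (simp add: inner_commute)
      have half: "1/2 * (2 * x + 2 * y) = y + x" for x y :: real by simp
      have "(\<epsilon> k has_vector_derivative 1/2 * (2 * (R k t \<bullet> ((1 / h k) *\<^sub>R (q (t + h k) - q t)))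
          + 2 * (P k t \<bullet> ((1 / h k) *\<^sub>R (p (t + h k) - p t))))) (at t within {a..c})"
        unfolding \<epsilon>_def
        by (intro bounded_linear.has_vector_derivative[OF bounded_linear_mult_right]
            has_vector_derivative_add sq dP dR)
      moreover have "1/2 * (2 * (R k t \<bullet> ((1 / h k) *\<^sub>R (q (t + h k) - q t)))
          + 2 * (P k t \<bullet> ((1 / h k) *\<^sub>R (p (t + h k) - p t))))
          = - (g k t \<bullet> P k t)"
        unfolding half by (rule key[OF t])
      ultimately show "(\<epsilon> k has_vector_derivative - (g k t \<bullet> P k t)) (at t within {a..c})"
        by (simp only:)
    qed
    \<comment> \<open>The mean value inequality bounds the difference quotients by \<open>CG\<close>
      and \<open>Cp\<close> uniformly in the step, which supplies the dominating constant.\<close>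
    have "(\<lambda>k. integral {a..c} (\<lambda>t. g k t \<bullet> P k t)) \<longlonglongrightarrow> integral {a..c} (\<lambda>t. G t \<bullet> p t)"
    proof (rule dominated_convergence(2))
      show "(\<lambda>t. g k t \<bullet> P k t) integrable_on {a..c}" for k
        using has_integral_neg[OF int[of k]] by (auto simp: integrable_on_def)
      show "(\<lambda>_. CG * Cp) integrable_on {a..c}" by (rule integrable_const_ivl)
      fix k t assume t: "t \<in> {a..c}"
      have "norm (g k t) \<le> CG" "norm (P k t) \<le> Cp" unfolding g_def P_def
        using difference_quotient_bound[OF \<Gamma> CG tb[OF t] hb[OF t] hp]
          difference_quotient_bound[OF u Cp tb[OF t] hb[OF t] hp] by auto
      thus "norm (g k t \<bullet> P k t) \<le> CG * Cp"
        using Cauchy_Schwarz_ineq2[of "g k t" "P k t"] mult_mono'[of "norm (g k t)" CG "norm (P k t)" Cp]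
        by simp
    next
      fix t assume t: "t \<in> {a..c}"
      show "(\<lambda>k. g k t \<bullet> P k t) \<longlonglongrightarrow> G t \<bullet> p t" by (intro tendsto_intros glim Plim t)
    qed
    moreover have "integral {a..c} (\<lambda>t. g k t \<bullet> P k t) = \<epsilon> k a - \<epsilon> k c" for k
      using has_integral_neg[OF int[of k]] by (simp add: integral_unique)
    moreover have "(\<lambda>k. \<epsilon> k t) \<longlonglongrightarrow> e t" if t: "t \<in> {a..c}" for t
      unfolding \<epsilon>_def e_def power2_norm_eq_inner by (intro tendsto_intros Rlim Plim t)
    hence "(\<lambda>k. \<epsilon> k a - \<epsilon> k c) \<longlonglongrightarrow> e a - e c" using c by (intro tendsto_diff) auto
    ultimately show ?thesis using LIMSEQ_unique by simp
  qed
  show ?thesis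
  proof (cases "a = b")
    case False
    hence ab: "a < b" using ab by simp
    \<comment> \<open>The defect of the identity is continuous in its right endpoint and vanishes on
      [a, b), hence also at b.\<close>
    define \<phi> where "\<phi> c = integral {a..c} (\<lambda>r. G r \<bullet> p r) - e a + e c" for c
    have "continuous_on {a..b} \<phi>" unfolding \<phi>_def e_def
      by (intro continuous_intros p q indefinite_integral_continuous_1 integrable_continuous_real G)
    moreover have "\<phi> c = 0" if "c \<in> {a..<b}" for c using inner_c that by (simp add: \<phi>_def)
    moreover have "closure {a..<b} = {a..b}" using ab by (rule closure_atLeastLessThan)
    ultimately have "\<phi> b = 0"
      using continuous_constant_on_closure[of "{a..<b}" \<phi> 0 b] ab by simp
    thus ?thesis by (simp add: \<phi>_def e_def)
  qed simp
qed

subsection \<open>Compact symmetric operators\<close>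

text \<open>A maximiser of \<open>norm (K x)\<close> on the unit ball of \<open>N\<close> satisfies \<open>K (K x) = s\<^sup>2 x\<close>; as
  \<open>K\<close> is nonnegative, \<open>K + s\<close> is injective, so already \<open>K x = s x\<close>.\<close>

lemma compact_symmetric_eigenvector:
  fixes K :: "'a::real_inner \<Rightarrow> 'a"
  assumes K: "bounded_linear K" and cpt: "compact (closure (K ` cball 0 1))"
    and sym: "\<And>x y. K x \<bullet> y = x \<bullet> K y" and pos: "\<And>x. 0 \<le> K x \<bullet> x"
    and inj: "\<And>x. K x = 0 \<Longrightarrow> x = 0"
    and N: "closed N" "subspace N" and KN: "\<And>x. x \<in> N \<Longrightarrow> K x \<in> N"
    and x0: "x0 \<in> N" "x0 \<noteq> 0"
  shows "\<exists>x\<in>N. \<exists>s>0. x \<noteq> 0 \<and> K x = s *\<^sub>R x"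
proof -
  interpret K: bounded_linear K by (rule K)
  \<comment> \<open>The maximum is sought in the compact closure of the image: at this stage its
    maximiser \<open>y\<close> is only a limit of values of \<open>K\<close>.\<close>
  define Y where "Y = closure (K ` (N \<inter> cball 0 1))"
  have "compact Y"
  proof -
    have "Y \<subseteq> closure (K ` cball 0 1)" unfolding Y_def by (intro closure_mono) auto
    thus ?thesis using cpt by (metis Y_def closed_closure compact_Int_closed inf.absorb_iff2)
  qed
  have KY: "K x \<in> Y" if "x \<in> N" "norm x \<le> 1" for x
    unfolding Y_def using that closure_subset by fastforce
  have "Y \<noteq> {}" using KY[of 0] subspace_0[OF N(2)] by auto
  then obtain y where y: "y \<in> Y" and ymax: "\<And>z. z \<in> Y \<Longrightarrow> norm z \<le> norm y"
    using continuous_attains_sup[OF \<open>compact Y\<close>, of norm] continuous_on_norm_id by blast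
  define s where "s = norm y"
  have Ks: "norm (K x) \<le> s * norm x" if "x \<in> N" for x
  proof (cases "x = 0")
    case False
    have "K ((1 / norm x) *\<^sub>R x) \<in> Y"
      using that False by (intro KY subspace_scale[OF N(2)]) auto
    from ymax[OF this] show ?thesis using False by (simp add: K.scaleR s_def field_simps)
  qed (simp add: K.zero)
  have "s > 0"
  proof (rule ccontr)
    assume "\<not> s > 0"
    hence "norm (K x0) \<le> 0" using Ks[OF x0(1)] by (smt (verit) mult_nonneg_nonneg norm_ge_zero mult_le_0_iff)
    thus False using inj x0(2) by simp
  qed
  obtain X where XN: "\<And>k. X k \<in> N" and X1: "\<And>k. norm (X k) \<le> 1" and KX: "(\<lambda>k. K (X k)) \<longlonglongrightarrow> y"
  proof -
    obtain Z where "\<And>k. Z k \<in> K ` (N \<inter> cball 0 1)" "Z \<longlonglongrightarrow> y"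
      using y unfolding Y_def closure_sequential by blast
    moreover from this(1) have "\<forall>k. \<exists>x\<in>N. norm x \<le> 1 \<and> Z k = K x" by fastforce
    then obtain X where "\<forall>k. X k \<in> N \<and> norm (X k) \<le> 1 \<and> Z k = K (X k)" by metis
    moreover from this have "Z = (\<lambda>k. K (X k))" by auto
    ultimately show ?thesis using that by blast
  qed
  \<comment> \<open>Expanding the square shows that the residual tends to 0, as
    \<open>norm (K (X k))\<close> tends to \<open>s\<close>. Solving for \<open>X k\<close> then
    gives norm convergence of the maximising sequence itself, without weak compactness of the
    ball.\<close>
  define R where "R k = K (K (X k)) - s\<^sup>2 *\<^sub>R X k" for k
  have R: "(norm (R k))\<^sup>2 \<le> s\<^sup>2 * (s\<^sup>2 - (norm (K (X k)))\<^sup>2)" for k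
  proof -
    have "(norm (R k))\<^sup>2 = (norm (K (K (X k))))\<^sup>2 - 2 * s\<^sup>2 * (K (K (X k)) \<bullet> X k) + s\<^sup>2 * s\<^sup>2 * (norm (X k))\<^sup>2"
      unfolding R_def power2_norm_eq_inner
      by (simp add: inner_diff inner_commute algebra_simps)
    moreover have "K (K (X k)) \<bullet> X k = (norm (K (X k)))\<^sup>2" by (simp add: sym power2_norm_eq_inner)
    moreover have "(norm (K (K (X k))))\<^sup>2 \<le> (s * norm (K (X k)))\<^sup>2"
      by (intro power_mono Ks KN XN) auto
    moreover have "s\<^sup>2 * s\<^sup>2 * (norm (X k))\<^sup>2 \<le> s\<^sup>2 * s\<^sup>2 * 1"
      using X1 by (intro mult_left_mono) (auto simp: power_le_one_iff)
    ultimately show ?thesis by (simp add: power_mult_distrib algebra_simps)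
  qed
  have "(\<lambda>k. s\<^sup>2 * (s\<^sup>2 - (norm (K (X k)))\<^sup>2)) \<longlonglongrightarrow> s\<^sup>2 * (s\<^sup>2 - (norm y)\<^sup>2)"
    by (intro tendsto_intros KX)
  hence "(\<lambda>k. s\<^sup>2 * (s\<^sup>2 - (norm (K (X k)))\<^sup>2)) \<longlonglongrightarrow> 0" by (simp add: s_def)
  hence "(\<lambda>k. (norm (R k))\<^sup>2) \<longlonglongrightarrow> 0"
    by (rule tendsto_sandwich[OF _ _ tendsto_const, rotated 2]) (use R in auto)
  hence "(\<lambda>k. norm (R k)) \<longlonglongrightarrow> 0" by (simp add: tendsto_power_zero power_tendsto_0_iff)
  hence "R \<longlonglongrightarrow> 0" by (simp add: tendsto_norm_zero_iff)
  hence "(\<lambda>k. (1 / s\<^sup>2) *\<^sub>R (K (K (X k)) - R k)) \<longlonglongrightarrow> (1 / s\<^sup>2) *\<^sub>R (K y - 0)"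
    by (intro tendsto_intros K.tendsto KX)
  moreover have "(1 / s\<^sup>2) *\<^sub>R (K (K (X k)) - R k) = X k" for k
    using \<open>s > 0\<close> by (simp add: R_def)
  ultimately have Xlim: "X \<longlonglongrightarrow> (1 / s\<^sup>2) *\<^sub>R K y" by simp
  define x where "x = (1 / s\<^sup>2) *\<^sub>R K y"
  have xN: "x \<in> N" using closed_sequentially[OF N(1) XN] Xlim by (simp add: x_def)
  have Kx: "K x = y" using K.tendsto[OF Xlim] KX LIMSEQ_unique unfolding x_def by blast
  have KKx: "K (K x) = s\<^sup>2 *\<^sub>R x" using \<open>s > 0\<close> unfolding Kx by (simp add: x_def)
  define z where "z = K x - s *\<^sub>R x"
  have "K z = - s *\<^sub>R z"
    by (simp add: z_def K.diff K.scaleR KKx power2_eq_square algebra_simps)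
  hence "0 \<le> - s * (z \<bullet> z)" using pos[of z] by simp
  hence "z \<bullet> z \<le> 0" using \<open>s > 0\<close> by (simp add: mult_le_0_iff)
  hence "z = 0" by (simp flip: power2_norm_eq_inner)
  moreover have "x \<noteq> 0" using Kx \<open>s > 0\<close> by (auto simp: s_def K.zero)
  ultimately show ?thesis using xN \<open>s > 0\<close> by (auto simp: z_def)
qed

text \<open>The orthogonal complement of all eigenvectors is closed and, by symmetry, invariant
  under \<open>K\<close>. Were it nontrivial, it would contain an eigenvector orthogonal to
  itself.\<close>

lemma compact_symmetric_eigenvectors_total:
  fixes K :: "'a::real_inner \<Rightarrow> 'a"
  assumes K: "bounded_linear K" and cpt: "compact (closure (K ` cball 0 1))"
    and sym: "\<And>x y. K x \<bullet> y = x \<bullet> K y" and pos: "\<And>x. 0 \<le> K x \<bullet> x"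
    and inj: "\<And>x. K x = 0 \<Longrightarrow> x = 0"
    and orth: "\<And>e s. s > 0 \<Longrightarrow> K e = s *\<^sub>R e \<Longrightarrow> x \<bullet> e = 0"
  shows "x = 0"
proof (rule ccontr)
  assume x: "x \<noteq> 0"
  define N where "N = {x. \<forall>e s. s > 0 \<longrightarrow> K e = s *\<^sub>R e \<longrightarrow> x \<bullet> e = 0}"
  have "closed N" unfolding N_def
    by (intro closed_Collect_all closed_Collect_imp open_Collect_const closed_Collect_eq continuous_intros)
  moreover have "subspace N" by (auto simp: N_def subspace_def inner_add_left)
  moreover have "K y \<in> N" if "y \<in> N" for y using that by (auto simp: N_def sym)
  moreover have "x \<in> N" using orth by (auto simp: N_def)
  ultimately obtain e s where "e \<in> N" "s > 0" "e \<noteq> 0" "K e = s *\<^sub>R e"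
    using compact_symmetric_eigenvector[OF K cpt sym pos inj, of N x] x by blast
  hence "e \<bullet> e = 0" unfolding N_def by blast
  thus False using \<open>e \<noteq> 0\<close> by simp
qed

subsection \<open>Undamped waves\<close>

lemma dt_eqI:
  assumes "(u has_vector_derivative d) (at t within {0..})" and "t \<ge> 0"
  shows "dt u t = d"
proof -
  have "at t within {0..} \<noteq> bot"
  proof -
    have "t islimpt {t..t + 1}" by (rule islimpt_Icc[THEN iffD2]) auto
    hence "t islimpt {0..}" by (rule islimpt_subset) (use assms(2) in auto)
    thus ?thesis by (simp add: trivial_limit_within)
  qed
  thus ?thesis unfolding dt_def using assms(1) by (rule vector_derivative_within)
qed

lemma C1_H_I:
  assumes "\<And>t. t \<ge> 0 \<Longrightarrow> (u has_vector_derivative u' t) (at t within {0..})"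
    and "continuous_on {0..} u'"
  shows "C1_H u" and "\<And>t. t \<ge> 0 \<Longrightarrow> dt u t = u' t"
proof -
  show dt: "dt u t = u' t" if "t \<ge> 0" for t using dt_eqI assms(1) that by blast
  have "continuous_on {0..} (dt u)" by (rule continuous_on_eq[OF assms(2)]) (simp add: dt)
  thus "C1_H u" unfolding C1_H_def using assms(1) dt by auto
qed

lemma symmetric_if_selfadjoint:
  "selfadjoint_operator E T \<Longrightarrow> x \<in> E \<Longrightarrow> y \<in> E \<Longrightarrow> T x \<bullet> y = x \<bullet> T y"
  unfolding selfadjoint_operator_def adjoint_graph_def by blast

section \<open>Eigenmodes of the operator and the waves they generate\<close>

locale sqrt_operator =
  fixes D V :: "'h::{real_inner, complete_space} set" and A S :: "'h \<Rightarrow> 'h"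
  assumes selfadjoint: "selfadjoint_operator D A" and positive: "positive_operator D A"
    and compact_inverse: "has_compact_inverse D A" and sqrt: "is_sqrt_operator V S D A"
begin

lemma subspace_V: "subspace V"
  and S_add: "x \<in> V \<Longrightarrow> y \<in> V \<Longrightarrow> S (x + y) = S x + S y"
  and S_scale: "x \<in> V \<Longrightarrow> S (c *\<^sub>R x) = c *\<^sub>R S x"
  using sqrt unfolding is_sqrt_operator_def selfadjoint_operator_def densely_defined_linear_def
  by auto

lemma S_diff: "x \<in> V \<Longrightarrow> y \<in> V \<Longrightarrow> S (x - y) = S x - S y"
  using S_add[of x "(- 1) *\<^sub>R y"] S_scale[of y "- 1"] subspace_scale[OF subspace_V, of y "- 1"] by simp

lemma S_symmetric: "x \<in> V \<Longrightarrow> y \<in> V \<Longrightarrow> S x \<bullet> y = x \<bullet> S y"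
  using sqrt symmetric_if_selfadjoint unfolding is_sqrt_operator_def by blast

lemma D_iff: "x \<in> D \<longleftrightarrow> x \<in> V \<and> S x \<in> V" and S_S: "x \<in> D \<Longrightarrow> S (S x) = A x"
  using sqrt unfolding is_sqrt_operator_def by auto

lemma S_surj: "\<exists>v\<in>V. S v = h"
proof -
  have "h \<in> A ` D" using compact_inverse by (simp add: has_compact_inverse_def bij_betw_def)
  then obtain x where "x \<in> D" "A x = h" by blast
  thus ?thesis using D_iff S_S by metis
qed

definition eigen :: "'h \<Rightarrow> real \<Rightarrow> bool" where
  "eigen e l \<longleftrightarrow> e \<in> D \<and> 0 < l \<and> A e = l *\<^sub>R e"

text \<open>Spectral theory is applied to the compact inverse of \<open>A\<close>, whose eigenvalues
  s correspond to eigenvalues 1/s of \<open>A\<close>.\<close>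

lemma eigen_total:
  assumes "\<And>e l. eigen e l \<Longrightarrow> x \<bullet> e = 0"
  shows "x = 0"
proof -
  define K where "K = inv_into D A"
  have bij: "bij_betw A D UNIV" and K: "bounded_linear K" "compact (closure (K ` cball 0 1))"
    using compact_inverse by (auto simp: has_compact_inverse_def compact_operator_def K_def)
  have KD: "K h \<in> D" and AK: "A (K h) = h" for h
    using bij unfolding K_def bij_betw_def by (auto intro: inv_into_into f_inv_into_f)
  have "K h \<bullet> k = h \<bullet> K k" for h k
    using symmetric_if_selfadjoint[OF selfadjoint KD KD, of h k] by (simp add: AK)
  moreover have "0 \<le> K h \<bullet> h" for h
    using positive KD[of h] AK[of h] by (metis positive_operator_def inner_commute)
  moreover have "h = 0" if "K h = 0" for h
    using KD[of h] AK[of h] that selfadjoint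
    unfolding selfadjoint_operator_def densely_defined_linear_def
    by (metis scaleR_zero_left)
  moreover have "x \<bullet> e = 0" if s: "s > 0" and e: "K e = s *\<^sub>R e" for e s
  proof (rule assms[of _ "1 / s"])
    have "e = (1 / s) *\<^sub>R K e" using s e by simp
    moreover have "A ((1 / s) *\<^sub>R K e) = (1 / s) *\<^sub>R e" "(1 / s) *\<^sub>R K e \<in> D"
      using KD[of e] AK[of e] selfadjoint
      unfolding selfadjoint_operator_def densely_defined_linear_def by (auto intro: subspace_scale)
    ultimately show "eigen e (1 / s)" unfolding eigen_def using s by auto
  qed
  ultimately show ?thesis by (rule compact_symmetric_eigenvectors_total[OF K])
qed

lemma eigen_V: "eigen e l \<Longrightarrow> e \<in> V" and eigen_S_V: "eigen e l \<Longrightarrow> S e \<in> V"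
  and eigen_S_S: "eigen e l \<Longrightarrow> S (S e) = l *\<^sub>R e"
  using D_iff S_S by (auto simp: eigen_def)

lemma C0_V_iff: "C0_V V S u \<longleftrightarrow> (\<forall>t\<ge>0. u t \<in> V) \<and> continuous_on {0..} (\<lambda>t. S (u t))"
proof -
  have "((\<lambda>s. norm_V S (u s - u t)) \<longlongrightarrow> 0) (at t within {0..}) \<longleftrightarrow>
      ((\<lambda>s. S (u s)) \<longlongrightarrow> S (u t)) (at t within {0..})" if "\<forall>t\<ge>0. u t \<in> V" "t \<ge> 0" for t
  proof -
    have "((\<lambda>s. norm_V S (u s - u t)) \<longlongrightarrow> 0) (at t within {0..}) \<longleftrightarrow>
        ((\<lambda>s. norm (S (u s) - S (u t))) \<longlongrightarrow> 0) (at t within {0..})"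
      by (rule Lim_cong_within) (use that in \<open>auto simp: norm_V_def S_diff\<close>)
    thus ?thesis unfolding tendsto_norm_zero_iff LIM_zero_iff .
  qed
  thus ?thesis unfolding C0_V_def continuous_on_def by auto
qed

lemma S_zero [simp]: "S 0 = 0"
  using S_scale[of 0 0] subspace_0[OF subspace_V] by simp

lemma wave_solution_zero: "wave_solution V S 0 0 (\<lambda>_. 0)"
proof -
  have "((\<lambda>_. 0::'h) has_vector_derivative 0) (at t within {0..})" for t :: real by simp
  note C1 = C1_H_I[OF this continuous_on_const]
  have "C0_V V S (\<lambda>_. 0)" unfolding C0_V_iff using subspace_0[OF subspace_V] by auto
  thus ?thesis unfolding wave_solution_def weak_solution_def using C1 by simp
qed

lemma wave_solution_add:
  assumes w: "wave_solution V S w0 w1 w" and z: "wave_solution V S z0 z1 z"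
  shows "wave_solution V S (w0 + z0) (w1 + z1) (\<lambda>t. w t + z t)"
proof -
  have V: "w t \<in> V" "z t \<in> V" if "t \<ge> 0" for t
    using w z that by (auto simp: wave_solution_def weak_solution_def C0_V_iff)
  have d: "((\<lambda>t. w t + z t) has_vector_derivative dt w t + dt z t) (at t within {0..})" if "t \<ge> 0" for t
    using w z that by (auto simp: wave_solution_def weak_solution_def C1_H_def
        intro!: has_vector_derivative_add)
  have cont: "continuous_on {0..} (\<lambda>t. dt w t + dt z t)"
    using w z by (auto simp: wave_solution_def weak_solution_def C1_H_def intro!: continuous_intros)
  note C1 = C1_H_I[OF d cont]
  have "continuous_on {0..} (\<lambda>t. S (w t) + S (z t))"
    using w z by (auto simp: wave_solution_def weak_solution_def C0_V_iff intro!: continuous_intros)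
  hence "continuous_on {0..} (\<lambda>t. S (w t + z t))"
    by (rule continuous_on_eq) (simp add: S_add V)
  hence "C0_V V S (\<lambda>t. w t + z t)"
    unfolding C0_V_iff using V by (auto simp: subspace_add[OF subspace_V])
  moreover have "((\<lambda>s. S (w s + z s) \<bullet> S v + 0 \<bullet> v) has_integral
      ((w1 + z1) \<bullet> v - dt (\<lambda>t. w t + z t) t \<bullet> v)) {0..t}" if v: "v \<in> V" and t: "t \<ge> 0" for v t
  proof -
    have "((\<lambda>s. S (w s) \<bullet> S v) has_integral (w1 \<bullet> v - dt w t \<bullet> v)) {0..t}"
      "((\<lambda>s. S (z s) \<bullet> S v) has_integral (z1 \<bullet> v - dt z t \<bullet> v)) {0..t}"
      using w z v t by (simp_all add: wave_solution_def weak_solution_def)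
    from has_integral_add[OF this]
    have "((\<lambda>s. S (w s) \<bullet> S v + S (z s) \<bullet> S v) has_integral
        ((w1 + z1) \<bullet> v - dt (\<lambda>t. w t + z t) t \<bullet> v)) {0..t}"
      using t by (simp add: C1(2) algebra_simps)
    thus ?thesis by (rule has_integral_eq[rotated]) (auto simp: S_add V inner_add_left)
  qed
  ultimately show ?thesis
    using w z C1 by (auto simp: wave_solution_def weak_solution_def)
qed

text \<open>On one mode the equation reduces to the oscillator f'' = -l f, because
  \<open>S e \<bullet> S v = l * (e \<bullet> v)\<close> by symmetry of \<open>S\<close>.\<close>

lemma wave_solution_eigen:
  assumes e: "eigen e l"
  shows "\<exists>w. wave_solution V S (\<alpha> *\<^sub>R e) (\<beta> *\<^sub>R e) w"
proof -
  define \<omega> where "\<omega> = sqrt l"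
  have l: "l > 0" and \<omega>: "\<omega> > 0" "\<omega> * \<omega> = l" using e by (auto simp: eigen_def \<omega>_def)
  define f where "f t = \<alpha> * cos (\<omega> * t) + \<beta> / \<omega> * sin (\<omega> * t)" for t
  define f' where "f' t = - \<alpha> * \<omega> * sin (\<omega> * t) + \<beta> * cos (\<omega> * t)" for t
  have f: "(f has_real_derivative f' t) (at t within X)" for t X
    unfolding f_def f'_def using \<omega> by (auto intro!: derivative_eq_intros simp: field_simps)
  have f': "(f' has_real_derivative - l * f t) (at t within X)" for t X
    unfolding f_def f'_def using \<omega> by (auto intro!: derivative_eq_intros simp: field_simps)
  have fc: "continuous_on X f" "continuous_on X f'" for X
    by (rule DERIV_continuous_on[OF f], rule DERIV_continuous_on[OF f'])
  define w where "w t = f t *\<^sub>R e" for t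
  have d: "(w has_vector_derivative f' t *\<^sub>R e) (at t within {0..})" for t
    unfolding w_def using has_vector_derivative_scaleR[OF f, of "\<lambda>_. e" 0] by simp
  have "continuous_on {0..} (\<lambda>t. f' t *\<^sub>R e)" by (intro continuous_intros fc)
  note C1 = C1_H_I[OF d this]
  have wV: "w t \<in> V" for t unfolding w_def using eigen_V[OF e] by (rule subspace_scale[OF subspace_V])
  have Sw: "S (w t) = f t *\<^sub>R S e" for t unfolding w_def by (rule S_scale[OF eigen_V[OF e]])
  have "C0_V V S w" unfolding C0_V_iff Sw using wV by (auto intro!: continuous_intros fc)
  moreover have "((\<lambda>s. S (w s) \<bullet> S v + 0 \<bullet> v) has_integral (\<beta> *\<^sub>R e \<bullet> v - dt w t \<bullet> v)) {0..t}"
    if v: "v \<in> V" and t: "t \<ge> 0" for v t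
  proof -
    have "S e \<bullet> S v = l * (e \<bullet> v)"
      using S_symmetric[OF eigen_S_V[OF e] v] eigen_S_S[OF e] by simp
    moreover have "((\<lambda>s. - l * f s) has_integral f' t - f' 0) {0..t}"
      using f' t by (intro fundamental_theorem_of_calculus)
        (auto simp: has_real_derivative_iff_has_vector_derivative)
    from has_integral_mult_right[OF this, of "- (e \<bullet> v)"]
    have "((\<lambda>s. f s * (l * (e \<bullet> v))) has_integral (f' 0 * (e \<bullet> v) - f' t * (e \<bullet> v))) {0..t}"
      by (simp add: algebra_simps)
    ultimately show ?thesis using t by (simp add: Sw C1(2)) (simp add: f'_def)
  qed
  ultimately have "wave_solution V S (\<alpha> *\<^sub>R e) (\<beta> *\<^sub>R e) w"
    unfolding wave_solution_def weak_solution_def using C1 by (auto simp: w_def f_def f'_def)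
  thus ?thesis by blast
qed

lemma wave_solution_span:
  assumes "w0 \<in> span {e. \<exists>l. eigen e l}" and "w1 \<in> span {e. \<exists>l. eigen e l}"
  shows "\<exists>w. wave_solution V S w0 w1 w"
proof -
  \<comment> \<open>Taking both data as multiples of one vector allows a single span induction;
    position and velocity data are superposed afterwards.\<close>
  have "\<exists>w. wave_solution V S (\<alpha> *\<^sub>R x) (\<beta> *\<^sub>R x) w" if "x \<in> span {e. \<exists>l. eigen e l}" for x \<alpha> \<beta>
    using that
  proof (induction rule: span_induct_alt)
    case base
    show ?case using wave_solution_zero by auto
  next
    case (step c x y)
    then obtain l w where "eigen x l" and w: "wave_solution V S (\<alpha> *\<^sub>R y) (\<beta> *\<^sub>R y) w" by blast
    then obtain z where "wave_solution V S ((\<alpha> * c) *\<^sub>R x) ((\<beta> * c) *\<^sub>R x) z"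
      using wave_solution_eigen by blast
    from wave_solution_add[OF this w] show ?case by (auto simp: scaleR_add_right)
  qed
  from this[OF assms(1), of 1 0] this[OF assms(2), of 0 1] obtain w z where
    "wave_solution V S w0 0 w" "wave_solution V S 0 w1 z" by auto
  from wave_solution_add[OF this] show ?thesis by auto
qed

lemma wave_solutions_dense:
  assumes u0: "u0 \<in> V" and r: "r > 0"
  shows "\<exists>w0\<in>V. \<exists>w1 w. wave_solution V S w0 w1 w \<and> norm (S u0 - S w0) < r \<and> norm (u1 - w1) < r"
proof -
  define E where "E = span {e. \<exists>l. eigen e l}"
  have E: "subspace E" by (simp add: E_def)
  have EV: "E \<subseteq> V" unfolding E_def by (rule span_minimal) (auto simp: eigen_V subspace_V)
  have eE: "e \<in> E" if "eigen e l" for e l using that by (auto simp: E_def intro: span_base)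
  have "closure E = UNIV"
    by (rule dense_subspace[OF E]) (use eE eigen_total in blast)
  moreover have "closure (S ` E) = UNIV"
  proof (rule dense_subspace)
    show "subspace (S ` E)" 
    proof (rule subspaceI)
      show "0 \<in> S ` E" using subspace_0[OF E] S_zero by force
    next
      fix x y assume "x \<in> S ` E" "y \<in> S ` E"
      then obtain v w where vw: "v \<in> E" "w \<in> E" "x = S v" "y = S w" by blast
      have "S (v + w) = x + y" unfolding vw(3,4) using vw(1,2) EV by (intro S_add) auto
      thus "x + y \<in> S ` E" using subspace_add[OF E vw(1,2)] by (metis image_eqI)
    next
      fix c x assume "x \<in> S ` E"
      then obtain v where v: "v \<in> E" "x = S v" by blast
      have "S (c *\<^sub>R v) = c *\<^sub>R x" unfolding v(2) using v(1) EV by (intro S_scale) auto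
      thus "c *\<^sub>R x \<in> S ` E" using subspace_scale[OF E v(1)] by (metis image_eqI)
    qed
    fix h assume h: "\<And>y. y \<in> S ` E \<Longrightarrow> h \<bullet> y = 0"
    obtain v where v: "v \<in> V" "S v = h" using S_surj by blast
    have "v = 0"
    proof (rule eigen_total)
      fix e l assume e: "eigen e l"
      have "l * (v \<bullet> e) = v \<bullet> S (S e)" using eigen_S_S[OF e] by simp
      also have "\<dots> = h \<bullet> S e" using S_symmetric[OF v(1) eigen_S_V[OF e]] v by simp
      also have "\<dots> = 0" using h eE[OF e] by blast
      finally show "v \<bullet> e = 0" using e by (auto simp: eigen_def)
    qed
    thus "h = 0" using v S_scale[of 0 0] by auto
  qed
  ultimately have "S u0 \<in> closure (S ` E)" "u1 \<in> closure E" by auto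
  hence "\<exists>y\<in>S ` E. dist y (S u0) < r" "\<exists>y\<in>E. dist y u1 < r"
    using r by (simp_all only: closure_approachable)
  then obtain w0 w1 where w: "w0 \<in> E" "dist (S w0) (S u0) < r" "w1 \<in> E" "dist w1 u1 < r" by blast
  obtain w where "wave_solution V S w0 w1 w" using wave_solution_span w(1,3) unfolding E_def by blast
  moreover have "norm (S u0 - S w0) < r" "norm (u1 - w1) < r"
    using w(2,4) by (simp_all add: dist_norm norm_minus_commute)
  ultimately show ?thesis using w(1) EV by blast
qed

end

subsection \<open>Decay and growth of the energy\<close>

text \<open>The inequality \<open>1 + x <= exp x\<close> replaces the product of the factors by an
  exponential, whatever the sign of a factor.\<close>

lemma perturbed_decay_tendsto_0:
  fixes e \<kappa> b :: "nat \<Rightarrow> real"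
  assumes e: "\<And>n. 0 \<le> e n" and step: "\<And>n. e (Suc n) \<le> e n * (1 - \<kappa> n + b n)"
    and b: "summable b" and \<kappa>: "filterlim (\<lambda>N. \<Sum>n<N. \<kappa> n) at_top sequentially"
  shows "e \<longlonglongrightarrow> 0"
proof -
  have bound: "e N \<le> e 0 * exp ((\<Sum>n<N. b n) - (\<Sum>n<N. \<kappa> n))" for N
  proof (induction N)
    case (Suc N)
    have "1 - \<kappa> N + b N \<le> exp (b N - \<kappa> N)"
      using exp_ge_add_one_self[of "b N - \<kappa> N"] by linarith
    note le = mult_left_mono[OF this e]
    have "e (Suc N) \<le> e N * (1 - \<kappa> N + b N)" by (rule step)
    also have "\<dots> \<le> e N * exp (b N - \<kappa> N)" by (rule le)
    also have "\<dots> \<le> e 0 * exp ((\<Sum>n<N. b n) - (\<Sum>n<N. \<kappa> n)) * exp (b N - \<kappa> N)"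
      using Suc by (intro mult_right_mono) auto
    also have "\<dots> = e 0 * exp ((\<Sum>n<Suc N. b n) - (\<Sum>n<Suc N. \<kappa> n))"
      by (simp add: exp_add[symmetric] mult.assoc algebra_simps)
    finally show ?case .
  qed simp
  have "(\<lambda>N. \<Sum>n<N. b n) \<longlonglongrightarrow> suminf b" using b by (rule summable_LIMSEQ)
  hence "filterlim (\<lambda>N. - (\<Sum>n<N. b n) + (\<Sum>n<N. \<kappa> n)) at_top sequentially"
    by (intro filterlim_tendsto_add_at_top[OF tendsto_minus \<kappa>])
  hence "filterlim (\<lambda>N. (\<Sum>n<N. b n) - (\<Sum>n<N. \<kappa> n)) at_bot sequentially"
    by (simp add: filterlim_uminus_at_bot)
  hence "(\<lambda>N. e 0 * exp ((\<Sum>n<N. b n) - (\<Sum>n<N. \<kappa> n))) \<longlonglongrightarrow> e 0 * 0"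
    by (intro tendsto_mult_left filterlim_compose[OF exp_at_bot])
  hence "(\<lambda>N. e 0 * exp ((\<Sum>n<N. b n) - (\<Sum>n<N. \<kappa> n))) \<longlonglongrightarrow> 0" by simp
  thus ?thesis
    by (rule tendsto_sandwich[OF _ _ tendsto_const, rotated 2]) (use e bound in auto)
qed

section \<open>Passage to the right endpoint of an interval\<close>

lemma C0_ext_continuous: "C0_ext a b B \<Longrightarrow> continuous_on {a..<b} B"
  unfolding C0_ext_def using continuous_on_eq continuous_on_subset
  by (metis atLeastLessThan_subseteq_atLeastAtMost_iff order_refl)

lemma C1_ext_continuous: "C1_ext a b B \<Longrightarrow> continuous_on {a..<b} B"
  by (rule C0_ext_continuous)
    (auto simp: C0_ext_def C1_ext_def continuous_on_eq_continuous_within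
      intro: has_vector_derivative_continuous)

lemma continuous_on_adj [continuous_intros]:
  fixes B :: "real \<Rightarrow> 'a::{real_inner, complete_space} \<Rightarrow>\<^sub>L 'b::real_inner"
  shows "continuous_on X B \<Longrightarrow> continuous_on X f \<Longrightarrow> continuous_on X (\<lambda>t. adj (B t) (f t))"
  by (rule bounded_bilinear.continuous_on[OF bounded_bilinear_adj])

lemma E_S_nonneg: "0 \<le> E_S S u t"
  by (simp add: E_S_def)

lemma norm_dt_le_E_S: "(norm (dt u t))\<^sup>2 \<le> 2 * E_S S u t"
  by (simp add: E_S_def)

text \<open>Carries energy bounds to the end of a slot, where the coefficient operators may jump but
  the energy does not.\<close>

lemma continuous_on_bound_right:
  fixes f :: "real \<Rightarrow> real"
  assumes "continuous_on {a..b} f" and "a < b" and "\<And>t. t \<in> {a..<b} \<Longrightarrow> f t \<le> c"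
  shows "f b \<le> c"
proof -
  have "closure {a..<b} = {a..b}" using assms(2) by (rule closure_atLeastLessThan)
  thus ?thesis using continuous_le_on_closure[of "{a..<b}" f b c] assms by auto
qed

lemma has_integral_Icc_diff:
  fixes f :: "real \<Rightarrow> real"
  assumes i: "(f has_integral i) {a..b}" and j: "(f has_integral j) {a..c}" and "a \<le> b" "b \<le> c"
  shows "(f has_integral j - i) {b..c}"
proof -
  have "f integrable_on {b..c}"
    by (rule integrable_on_subinterval[OF has_integral_integrable[OF j]]) (use \<open>a \<le> b\<close> in auto)
  then obtain k where k: "(f has_integral k) {b..c}" unfolding integrable_on_def by auto
  have "j = i + k" by (rule has_integral_unique[OF j has_integral_combine[OF assms(3,4) i k]])
  thus ?thesis using k by simp
qed

section \<open>Energy estimates for weak solutions\<close>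

context sqrt_operator
begin

lemma weak_solution_parts:
  assumes "weak_solution V S F u0 u1 u"
  shows "t \<ge> 0 \<Longrightarrow> u t \<in> V" and "continuous_on {0..} (\<lambda>t. S (u t))"
    and "t \<ge> 0 \<Longrightarrow> (u has_vector_derivative dt u t) (at t within {0..})"
    and "continuous_on {0..} (dt u)" and "u 0 = u0" and "dt u 0 = u1"
  using assms by (auto simp: weak_solution_def C0_V_iff C1_H_def)

text \<open>The weak equation is integrated from time 0, whereas the forcing has the form
  \<open>G\<close> only on the interval at hand; subtracting two integrals restarts it at
  \<open>a\<close>.\<close>

lemma weak_solution_interval:
  assumes sol: "weak_solution V S F u0 u1 u" and v: "v \<in> V" and a: "0 \<le> a" "a \<le> t"
    and F: "\<And>r. r \<in> {a..t} \<Longrightarrow> F r = G r"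
  shows "((\<lambda>r. S (u r) \<bullet> S v + G r \<bullet> v) has_integral (dt u a \<bullet> v - dt u t \<bullet> v)) {a..t}"
proof -
  have "((\<lambda>r. S (u r) \<bullet> S v + F r \<bullet> v) has_integral (u1 \<bullet> v - dt u s \<bullet> v)) {0..s}" if "s \<ge> 0" for s
    using sol v that unfolding weak_solution_def by blast
  from has_integral_Icc_diff[OF this[of a] this[of t]]
  have "((\<lambda>r. S (u r) \<bullet> S v + F r \<bullet> v) has_integral (dt u a \<bullet> v - dt u t \<bullet> v)) {a..t}"
    using a by simp
  thus ?thesis by (rule has_integral_eq[rotated]) (simp add: F)
qed

lemma continuous_E_S:
  assumes "weak_solution V S F u0 u1 u"
  shows "continuous_on {0..} (E_S S u)"
  unfolding E_S_def norm_V_def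
  by (intro continuous_intros weak_solution_parts[OF assms])

lemma weak_solution_energy:
  assumes sol: "weak_solution V S F u0 u1 u" and a: "0 \<le> a" "a \<le> b"
    and G: "continuous_on {a..b} G" and F: "\<And>r. r \<in> {a..b} \<Longrightarrow> F r = G r"
  shows "integral {a..b} (\<lambda>r. G r \<bullet> dt u r) = E_S S u a - E_S S u b"
proof -
  note parts = weak_solution_parts[OF sol]
  have sub: "{a..b} \<subseteq> {0..}" using a by auto
  show ?thesis unfolding E_S_def norm_V_def
  proof (rule energy_identity[OF a(2), where V = V and S = S and u = u])
    fix t assume t: "t \<in> {a..b}"
    show "(u has_vector_derivative dt u t) (at t within {a..b})"
      by (rule has_vector_derivative_within_subset[OF parts(3) sub]) (use t a in auto)
    show "u t \<in> V" using parts(1) t a by auto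
    fix v assume "v \<in> V"
    thus "((\<lambda>r. S (u r) \<bullet> S v + G r \<bullet> v) has_integral dt u a \<bullet> v - dt u t \<bullet> v) {a..t}"
      using t a F by (intro weak_solution_interval[OF sol]) auto
  qed (use parts sub G S_diff S_scale subspace_V in \<open>auto intro: continuous_on_subset\<close>)
qed

lemma damped_energy:
  fixes B :: "real \<Rightarrow> 'u::{real_inner, complete_space} \<Rightarrow>\<^sub>L 'h"
  assumes sol: "weak_solution V S F u0 u1 u" and a: "0 \<le> a" "a \<le> b"
    and B: "continuous_on {a..b} B"
    and F: "\<And>t. t \<in> {a..b} \<Longrightarrow> F t = blinfun_apply (B t) (adj (B t) (dt u t))"
  shows "integral {a..b} (\<lambda>t. (norm (adj (B t) (dt u t)))\<^sup>2) = E_S S u a - E_S S u b"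
proof -
  have "continuous_on {a..b} (dt u)"
    using weak_solution_parts(4)[OF sol] a by (auto intro: continuous_on_subset)
  hence "continuous_on {a..b} (\<lambda>t. blinfun_apply (B t) (adj (B t) (dt u t)))"
    by (intro continuous_intros B)
  from weak_solution_energy[OF sol a this F] show ?thesis
    by (simp add: inner_adj power2_norm_eq_inner)
qed

lemma damped_energy_decreasing:
  fixes B :: "real \<Rightarrow> 'u::{real_inner, complete_space} \<Rightarrow>\<^sub>L 'h"
  assumes sol: "weak_solution V S F u0 u1 u" and a: "0 \<le> a"
    and B: "continuous_on {a..<b} B"
    and F: "\<And>t. t \<in> {a..<b} \<Longrightarrow> F t = blinfun_apply (B t) (adj (B t) (dt u t))"
    and st: "a \<le> s" "s \<le> t" "t \<le> b"
  shows "E_S S u t \<le> E_S S u s"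
proof -
  have decr: "E_S S u r \<le> E_S S u s" if "s \<le> r" "r < b" for r
  proof -
    have "continuous_on {s..r} B" using B by (rule continuous_on_subset) (use that st in auto)
    from damped_energy[OF sol _ that(1) this F]
    have "E_S S u s - E_S S u r = integral {s..r} (\<lambda>t. (norm (adj (B t) (dt u t)))\<^sup>2)"
      using a st that by simp
    \<comment> \<open>A function that is not integrable has \<open>integral\<close> 0 by default, so
      the sign holds in both cases.\<close>
    also have "\<dots> \<ge> 0"
      by (cases "(\<lambda>t. (norm (adj (B t) (dt u t)))\<^sup>2) integrable_on {s..r}")
        (auto intro: Henstock_Kurzweil_Integration.integral_nonneg simp: not_integrable_integral)
    finally show ?thesis by simp
  qed
  show ?thesis
  proof (cases "t < b")
    case False
    show ?thesis
    proof (cases "s < b")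
      case True
      have "E_S S u b \<le> E_S S u s"
      proof (rule continuous_on_bound_right[OF _ True])
        show "continuous_on {s..b} (E_S S u)"
          using continuous_E_S[OF sol] by (rule continuous_on_subset) (use a st in auto)
      qed (use decr in auto)
      thus ?thesis using False st by simp
    next
      case False
      hence "s = t" using st by simp
      thus ?thesis by simp
    qed
  qed (use decr st in auto)
qed

text \<open>The solution is compared with an undamped wave \<open>w\<close> whose data at time \<open>a\<close> are within \<open>r\<close> of
  those of \<open>u\<close>. Such waves exist for every \<open>r > 0\<close> as finite sums of eigenmodes, so the Cauchy problem
  never has to be solved for general data.\<close>

lemma damped_observability:
  fixes B :: "real \<Rightarrow> 'u::{real_inner, complete_space} \<Rightarrow>\<^sub>L 'h"
    and j :: "'h \<Rightarrow> 'w::real_inner"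
  assumes sol: "weak_solution V S F u0 u1 u" and a: "0 \<le> a" and T: "0 < T"
    and B: "continuous_on {a..a + T} B"
    and F: "\<And>t. t \<in> {a..a + T} \<Longrightarrow> F t = blinfun_apply (B t) (adj (B t) (dt u t))"
    and lower: "\<And>t v. t \<in> {a..a + T} \<Longrightarrow> m * (norm (j v))\<^sup>2 \<le> (norm (adj (B t) v))\<^sup>2"
    and upper: "\<And>t v. t \<in> {a..a + T} \<Longrightarrow> (norm (adj (B t) v))\<^sup>2 \<le> M * (norm (j v))\<^sup>2"
    and m: "0 < m" and M: "0 < M" and j: "continuous_embedding j C" and c: "0 < c"
    and obs: "\<And>w0 w1 w. w0 \<in> V \<Longrightarrow> wave_solution V S w0 w1 w \<Longrightarrow>
      1/2 * ((norm_V S w0)\<^sup>2 + (norm w1)\<^sup>2) \<le> c * integral {0..T} (\<lambda>s. (norm (j (dt w s)))\<^sup>2)"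
  shows "E_S S u a \<le> 2 * c * (1 / m + 4 * C\<^sup>2 * T\<^sup>2 * M) * (E_S S u a - E_S S u (a + T))"
proof -
  define f where "f t = adj (B t) (dt u t)" for t
  define J where "J = integral {a..a + T} (\<lambda>t. (norm (f t))\<^sup>2)"
  have C: "0 < C" and jC: "(norm (j v))\<^sup>2 \<le> C * (norm v)\<^sup>2" and lin: "linear j" for v
    using j by (auto simp: continuous_embedding_def)
  have blj: "bounded_linear j"
  proof (rule bounded_linear.intro)
    show "bounded_linear_axioms j"
    proof (rule bounded_linear_axioms.intro, intro exI allI)
      fix v
      have "norm (j v) \<le> sqrt (C * (norm v)\<^sup>2)" using jC by (rule real_le_rsqrt)
      thus "norm (j v) \<le> norm v * sqrt C" by (simp add: real_sqrt_mult mult.commute)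
    qed
  qed (rule lin)
  note parts = weak_solution_parts[OF sol]
  have uc: "continuous_on {a..a + T} (dt u)"
    using parts(4) a by (auto intro: continuous_on_subset)
  have fc: "continuous_on {a..a + T} f" unfolding f_def by (intro continuous_intros B uc)
  have J: "J = E_S S u a - E_S S u (a + T)" unfolding J_def f_def
    using a T by (intro damped_energy[OF sol _ _ B F]) auto
  have approx: "1/2 * ((norm (S w0))\<^sup>2 + (norm w1)\<^sup>2) \<le>
      c * (2 / m * J + 2 * C * T * (4 * r\<^sup>2 + 4 * T * M * C * J))"
    if w0: "w0 \<in> V" and w: "wave_solution V S w0 w1 w"
      and r: "norm (S (u a) - S w0) < r" "norm (dt u a - w1) < r" for w0 w1 w r
  proof -
    note wparts = weak_solution_parts[OF w[unfolded wave_solution_def]]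
    define z where "z t = u t - w (t - a)" for t
    define p where "p t = dt u t - dt w (t - a)" for t
    define q where "q t = S (u t) - S (w (t - a))" for t
    define G where "G t = blinfun_apply (B t) (f t)" for t
    have sh: "continuous_on {a..a + T} (\<lambda>t. g (t - a))" if "continuous_on {0..} g" for g :: "real \<Rightarrow> 'h"
      using that by (rule continuous_on_compose2) (auto intro!: continuous_intros)
    have wc: "continuous_on {a..a + T} (\<lambda>t. dt w (t - a))" by (rule sh[OF wparts(4)])
    have pc: "continuous_on {a..a + T} p" unfolding p_def by (intro continuous_intros uc wc)
    have Sc: "continuous_on {a..a + T} (\<lambda>t. S (u t))"
      using parts(2) by (rule continuous_on_subset) (use a in auto)
    have qc: "continuous_on {a..a + T} q" unfolding q_def
      by (intro continuous_intros Sc sh[OF wparts(2)])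
    have Gc: "continuous_on {a..a + T} G" unfolding G_def by (intro continuous_intros B fc)
    have zV: "z t \<in> V" and qz: "q t = S (z t)" if "t \<ge> a" for t
      unfolding z_def q_def using parts(1) wparts(1) that a
      by (auto intro!: subspace_diff[OF subspace_V] simp: S_diff)
    have dz: "(z has_vector_derivative p t) (at t within {a..a + T})" if t: "t \<in> {a..a + T}" for t
    proof -
      have "(u has_vector_derivative dt u t) (at t within {a..a + T})"
        by (rule has_vector_derivative_within_subset[OF parts(3)]) (use t a in auto)
      moreover have "((\<lambda>t. w (t + - a)) has_vector_derivative dt w (t + - a)) (at t within {a..a + T})"
        using t by (intro has_vector_derivative_shift[where X = "{0..}"] wparts(3)) auto
      ultimately show ?thesis unfolding z_def p_def by (auto intro: has_vector_derivative_diff)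
    qed
    have weak: "((\<lambda>r. q r \<bullet> S v + G r \<bullet> v) has_integral (p a \<bullet> v - p t \<bullet> v)) {a..t}"
      if v: "v \<in> V" and t: "t \<in> {a..a + T}" for v t
    proof -
      have "((\<lambda>r. S (u r) \<bullet> S v + G r \<bullet> v) has_integral (dt u a \<bullet> v - dt u t \<bullet> v)) {a..t}"
        using t a F by (intro weak_solution_interval[OF sol v]) (auto simp: G_def f_def)
      moreover have "((\<lambda>r. S (w r) \<bullet> S v) has_integral (w1 \<bullet> v - dt w (t - a) \<bullet> v)) {0..t - a}"
        using w v t by (simp add: wave_solution_def weak_solution_def)
      hence "((\<lambda>r. S (w (r - a)) \<bullet> S v) has_integral (w1 \<bullet> v - dt w (t - a) \<bullet> v)) {a..t}"
        using has_integral_shift_Icc_real[of "\<lambda>r. S (w (r - a)) \<bullet> S v" a _ 0 "t - a"]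
        by (simp add: o_def)
      ultimately have "((\<lambda>r. (S (u r) \<bullet> S v + G r \<bullet> v) - S (w (r - a)) \<bullet> S v) has_integral
          ((dt u a \<bullet> v - dt u t \<bullet> v) - (w1 \<bullet> v - dt w (t - a) \<bullet> v))) {a..t}"
        by (rule has_integral_diff)
      thus ?thesis unfolding q_def p_def using wparts(6) by (simp add: algebra_simps)
    qed
    have sub: "{a..s} \<subseteq> {a..a + T}" if "s \<in> {a..a + T}" for s using that by auto
    have energy: "integral {a..s} (\<lambda>t. G t \<bullet> p t) = 1/2 * ((norm (q a))\<^sup>2 + (norm (p a))\<^sup>2)
        - 1/2 * ((norm (q s))\<^sup>2 + (norm (p s))\<^sup>2)" if s: "s \<in> {a..a + T}" for s
    proof (rule energy_identity[where V = V and S = S and u = z])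
      fix t assume "t \<in> {a..s}"
      hence t: "t \<in> {a..a + T}" using s by auto
      show "(z has_vector_derivative p t) (at t within {a..s})"
        using dz[OF t] sub[OF s] by (rule has_vector_derivative_within_subset)
      show "z t \<in> V" "q t = S (z t)" using zV qz t by auto
      fix v assume "v \<in> V"
      thus "((\<lambda>r. q r \<bullet> S v + G r \<bullet> v) has_integral (p a \<bullet> v - p t \<bullet> v)) {a..t}" using weak t by blast
    qed (use s pc qc Gc continuous_on_subset[OF _ sub[OF s]] subspace_V S_diff S_scale in auto)
    have "{a..a + T} \<noteq> {}" using T by auto
    \<comment> \<open>The energy balance is evaluated at the time where the velocity of the
      difference is largest, so that the same quantity \<open>y\<close> appears on both
      sides.\<close>
    then obtain s0 where s0: "s0 \<in> {a..a + T}" "\<And>t. t \<in> {a..a + T} \<Longrightarrow> norm (p t) \<le> norm (p s0)"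
      using continuous_attains_sup[OF compact_Icc _ continuous_on_norm[OF pc]] by blast
    define y where "y = norm (p s0)"
    have Gp: "\<bar>G t \<bullet> p t\<bar> \<le> T * M * C * (norm (f t))\<^sup>2 + y\<^sup>2 / (4 * T)" if t: "t \<in> {a..a + T}" for t
    proof -
      define g where "g = adj (B t) (p t)"
      have "(norm g)\<^sup>2 \<le> M * (norm (j (p t)))\<^sup>2" unfolding g_def by (rule upper[OF t])
      also have "\<dots> \<le> M * (C * (norm (p t))\<^sup>2)" using jC M by (intro mult_left_mono) auto
      also have "\<dots> \<le> M * (C * y\<^sup>2)"
        using M C s0(2)[OF t] by (intro mult_left_mono power_mono) (auto simp: y_def)
      finally have g: "(norm g)\<^sup>2 \<le> M * C * y\<^sup>2" by simp
      \<comment> \<open>This weight in Young's inequality leaves \<open>y^2 / (4 * T)\<close>, hence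
        at most \<open>y^2 / 4\<close> after integration in time, which is absorbed by the
        \<open>y^2 / 2\<close> of the energy at \<open>s0\<close>.\<close>
      define \<theta> where "\<theta> = T * M * C"
      have \<theta>: "\<theta> > 0" using T M C by (simp add: \<theta>_def)
      have "0 \<le> (2 * \<theta> * norm (f t) - norm g)\<^sup>2" by simp
      hence "4 * \<theta> * (norm (f t) * norm g) \<le> 4 * \<theta> * (\<theta> * (norm (f t))\<^sup>2) + (norm g)\<^sup>2"
        by (simp add: power2_diff power2_eq_square algebra_simps)
      hence "norm (f t) * norm g \<le> \<theta> * (norm (f t))\<^sup>2 + (norm g)\<^sup>2 / (4 * \<theta>)"
        using \<theta> by (simp add: field_simps)
      also have "(norm g)\<^sup>2 / (4 * \<theta>) \<le> M * C * y\<^sup>2 / (4 * \<theta>)"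
        using g \<theta> by (intro divide_right_mono) auto
      also have "M * C * y\<^sup>2 / (4 * \<theta>) = y\<^sup>2 / (4 * T)" using M C T by (simp add: \<theta>_def)
      finally have "norm (f t) * norm g \<le> \<theta> * (norm (f t))\<^sup>2 + y\<^sup>2 / (4 * T)" by simp
      moreover have "\<bar>G t \<bullet> p t\<bar> \<le> norm (f t) * norm g"
        unfolding G_def inner_adj g_def by (rule Cauchy_Schwarz_ineq2)
      ultimately show ?thesis by (simp add: \<theta>_def)
    qed
    have rhs_int: "(\<lambda>t. T * M * C * (norm (f t))\<^sup>2 + y\<^sup>2 / (4 * T)) integrable_on {a..a + T}"
      by (intro integrable_continuous_real continuous_intros fc)
    have "norm (integral {a..s0} (\<lambda>t. G t \<bullet> p t)) \<le>
        integral {a..s0} (\<lambda>t. T * M * C * (norm (f t))\<^sup>2 + y\<^sup>2 / (4 * T))"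
    proof (rule integral_norm_bound_integral)
      show "(\<lambda>t. G t \<bullet> p t) integrable_on {a..s0}"
        by (intro integrable_continuous_real continuous_on_subset[OF _ sub[OF s0(1)]]
            continuous_intros Gc pc)
      show "(\<lambda>t. T * M * C * (norm (f t))\<^sup>2 + y\<^sup>2 / (4 * T)) integrable_on {a..s0}"
        using integrable_on_subinterval[OF rhs_int sub[OF s0(1)]] .
    qed (use Gp sub[OF s0(1)] in auto)
    also have "\<dots> \<le> integral {a..a + T} (\<lambda>t. T * M * C * (norm (f t))\<^sup>2 + y\<^sup>2 / (4 * T))"
      using integrable_on_subinterval[OF rhs_int sub[OF s0(1)]] rhs_int sub[OF s0(1)] T M C
      by (intro integral_subset_le) auto
    also have "\<dots> = T * M * C * J + y\<^sup>2 / 4"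
      using T by (subst Henstock_Kurzweil_Integration.integral_add)
        (auto simp: J_def intro!: integrable_continuous_real continuous_intros fc)
    finally have "\<bar>integral {a..s0} (\<lambda>t. G t \<bullet> p t)\<bar> \<le> T * M * C * J + y\<^sup>2 / 4" by simp
    moreover have "(norm (q a))\<^sup>2 \<le> r\<^sup>2" "(norm (p a))\<^sup>2 \<le> r\<^sup>2"
      using r wparts(5,6) unfolding q_def p_def by (auto intro!: power_mono)
    moreover have "0 \<le> (norm (q s0))\<^sup>2" by simp
    ultimately have y: "y\<^sup>2 \<le> 4 * r\<^sup>2 + 4 * T * M * C * J"
      using energy[OF s0(1)] unfolding y_def by argo
    have jw: "(norm (j (dt w (t - a))))\<^sup>2 \<le> 2 / m * (norm (f t))\<^sup>2 + 2 * C * y\<^sup>2"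
      if t: "t \<in> {a..a + T}" for t
    proof -
      have "j (dt w (t - a)) = j (dt u t) - j (p t)"
        using linear_diff[OF lin, of "dt u t" "p t"] by (simp add: p_def)
      hence "(norm (j (dt w (t - a))))\<^sup>2 \<le> (norm (j (dt u t)) + norm (j (p t)))\<^sup>2"
        using norm_triangle_ineq4[of "j (dt u t)" "j (p t)"] by (auto intro: power_mono)
      also have "\<dots> \<le> 2 * (norm (j (dt u t)))\<^sup>2 + 2 * (norm (j (p t)))\<^sup>2"
        using sum_squares_bound[of "norm (j (dt u t))" "norm (j (p t))"]
        by (simp add: power2_sum)
      also have "(norm (j (dt u t)))\<^sup>2 \<le> (norm (f t))\<^sup>2 / m"
        using lower[OF t, of "dt u t"] m by (simp add: f_def field_simps)
      also have "(norm (j (p t)))\<^sup>2 \<le> C * (norm (p t))\<^sup>2" by (rule jC)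
      also have "C * (norm (p t))\<^sup>2 \<le> C * y\<^sup>2"
        using C s0(2)[OF t] by (intro mult_left_mono power_mono) (auto simp: y_def)
      finally show ?thesis by simp
    qed
    have "integral {0..T} (\<lambda>s. (norm (j (dt w s)))\<^sup>2) = integral {a..a + T} (\<lambda>t. (norm (j (dt w (t - a))))\<^sup>2)"
      using integral_shift_Icc_real[of 0 T "\<lambda>t. (norm (j (dt w (t - a))))\<^sup>2" a]
      by (simp add: o_def add.commute)
    also have "\<dots> \<le> integral {a..a + T} (\<lambda>t. 2 / m * (norm (f t))\<^sup>2 + 2 * C * y\<^sup>2)"
    proof (rule integral_le)
      show "(\<lambda>t. (norm (j (dt w (t - a))))\<^sup>2) integrable_on {a..a + T}"
        by (intro integrable_continuous_real continuous_intros bounded_linear.continuous_on[OF blj] wc)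
      show "(\<lambda>t. 2 / m * (norm (f t))\<^sup>2 + 2 * C * y\<^sup>2) integrable_on {a..a + T}"
        by (intro integrable_continuous_real continuous_intros fc)
    qed (use jw in auto)
    also have "\<dots> = 2 / m * J + 2 * C * T * y\<^sup>2"
      using T m by (subst Henstock_Kurzweil_Integration.integral_add)
        (auto simp: J_def intro!: integrable_continuous_real continuous_intros fc)
    also have "\<dots> \<le> 2 / m * J + 2 * C * T * (4 * r\<^sup>2 + 4 * T * M * C * J)"
      using y C T by (intro add_left_mono mult_left_mono) auto
    finally have "c * integral {0..T} (\<lambda>s. (norm (j (dt w s)))\<^sup>2) \<le>
        c * (2 / m * J + 2 * C * T * (4 * r\<^sup>2 + 4 * T * M * C * J))"
      using c by (intro mult_left_mono) auto
    thus ?thesis by (rule order_trans[OF obs[OF w0 w, unfolded norm_V_def]])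
  qed
  \<comment> \<open>The right side of \<open>approx\<close> depends on the wave only through the
    error \<open>r\<close>, so only the data at time \<open>a\<close> have to converge.\<close>
  define r where "r k = 1 / real (Suc k)" for k
  have r0: "r \<longlonglongrightarrow> 0" unfolding r_def using LIMSEQ_Suc[OF lim_const_over_n[of 1]] by simp
  have "\<exists>w0 w1. norm (S (u a) - S w0) < r k \<and> norm (dt u a - w1) < r k \<and>
      1/2 * ((norm (S w0))\<^sup>2 + (norm w1)\<^sup>2) \<le> c * (2 / m * J + 2 * C * T * (4 * (r k)\<^sup>2 + 4 * T * M * C * J))"
    for k
    using wave_solutions_dense[OF parts(1)[OF a], of "r k" "dt u a"] approx
    by (fastforce simp: r_def)
  then obtain w0 w1 where w: "\<And>k. norm (S (u a) - S (w0 k)) < r k" "\<And>k. norm (dt u a - w1 k) < r k"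
    "\<And>k. 1/2 * ((norm (S (w0 k)))\<^sup>2 + (norm (w1 k))\<^sup>2) \<le>
      c * (2 / m * J + 2 * C * T * (4 * (r k)\<^sup>2 + 4 * T * M * C * J))" by metis
  have lim: "X \<longlonglongrightarrow> x" if "\<And>k. norm (x - X k) < r k" for X and x :: 'h
  proof -
    have "(\<lambda>k. X k - x) \<longlonglongrightarrow> 0"
      by (rule Lim_null_comparison[OF _ r0]) (use that in \<open>auto simp: norm_minus_commute less_imp_le\<close>)
    thus ?thesis by (simp add: LIM_zero_iff)
  qed
  have "1/2 * ((norm (S (u a)))\<^sup>2 + (norm (dt u a))\<^sup>2) \<le>
      c * (2 / m * J + 2 * C * T * (4 * 0\<^sup>2 + 4 * T * M * C * J))"
  proof (rule LIMSEQ_le)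
    show "(\<lambda>k. 1/2 * ((norm (S (w0 k)))\<^sup>2 + (norm (w1 k))\<^sup>2)) \<longlonglongrightarrow>
        1/2 * ((norm (S (u a)))\<^sup>2 + (norm (dt u a))\<^sup>2)"
      by (intro tendsto_intros lim w)
    show "(\<lambda>k. c * (2 / m * J + 2 * C * T * (4 * (r k)\<^sup>2 + 4 * T * M * C * J))) \<longlonglongrightarrow>
        c * (2 / m * J + 2 * C * T * (4 * 0\<^sup>2 + 4 * T * M * C * J))"
      by (intro tendsto_intros r0)
    show "\<exists>N. \<forall>k\<ge>N. 1/2 * ((norm (S (w0 k)))\<^sup>2 + (norm (w1 k))\<^sup>2) \<le>
        c * (2 / m * J + 2 * C * T * (4 * (r k)\<^sup>2 + 4 * T * M * C * J))"
      using w(3) by blast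
  qed
  also have "\<dots> = 2 * c * (1 / m + 4 * C\<^sup>2 * T\<^sup>2 * M) * J"
    by (simp add: power2_eq_square algebra_simps)
  finally show ?thesis unfolding J by (simp add: E_S_def norm_V_def)
qed

text \<open>With e^2 = \<open>E0\<close> bounding the past and y^2 the largest energy so far, the
  delay term is at most 2 K e y in absolute value. Integration gives y^2 <= e^2 + 2 \<alpha> e y
  with \<alpha> = K (d - b), hence y <= e (1 + 2 \<alpha>).\<close>

lemma delayed_energy_growth:
  fixes B :: "real \<Rightarrow> 'u::{real_inner, complete_space} \<Rightarrow>\<^sub>L 'h"
  assumes sol: "weak_solution V S F u0 u1 u" and b: "0 \<le> b" "b < d" and \<tau>: "0 \<le> b - \<tau>"
    and B: "continuous_on {b..<d} B"
    and F: "\<And>t. t \<in> {b..<d} \<Longrightarrow> F t = blinfun_apply (B t) (adj (B t) (dt u (t - \<tau>)))"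
    and upper: "\<And>t v. t \<in> {b..<d} \<Longrightarrow> (norm (adj (B t) v))\<^sup>2 \<le> K * (norm v)\<^sup>2"
    and K: "0 \<le> K" and past: "\<And>t. t \<in> {b..<d} \<Longrightarrow> (norm (dt u (t - \<tau>)))\<^sup>2 \<le> 2 * E0"
    and E0: "E_S S u b \<le> E0" and t: "t \<in> {b..d}"
  shows "E_S S u t \<le> E_S S u b + 2 * (K * (d - b)) * (1 + 2 * (K * (d - b))) * E0"
proof -
  define \<alpha> where "\<alpha> = K * (d - b)"
  have \<alpha>: "0 \<le> \<alpha>" using K b by (simp add: \<alpha>_def)
  have E0': "0 \<le> E0" using E0 E_S_nonneg[of S u b] by linarith
  have open_bound: "E_S S u t \<le> E_S S u b + 2 * \<alpha> * (1 + 2 * \<alpha>) * E0" if t: "t \<in> {b..<d}" for t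
  proof -
    have Ec: "continuous_on {b..t} (E_S S u)"
      using continuous_E_S[OF sol] by (rule continuous_on_subset) (use b in auto)
    have "{b..t} \<noteq> {}" using t by auto
    then obtain s0 where s0: "s0 \<in> {b..t}" "\<And>s. s \<in> {b..t} \<Longrightarrow> E_S S u s \<le> E_S S u s0"
      using continuous_attains_sup[OF compact_Icc _ Ec] by blast
    define y where "y = sqrt (E_S S u s0)"
    define e where "e = sqrt E0"
    have y: "0 \<le> y" "y\<^sup>2 = E_S S u s0" and e: "0 \<le> e" "e\<^sup>2 = E0"
      using E_S_nonneg[of S u s0] E0' by (auto simp: y_def e_def)
    have bound: "\<bar>E_S S u s - E_S S u b\<bar> \<le> 2 * \<alpha> * e * y" if s: "s \<in> {b..t}" for s
    proof -
      have sub: "{b..s} \<subseteq> {b..<d}" using s t by auto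
      have dtc: "continuous_on {b..s} (\<lambda>r. dt u (r - \<tau>))"
        by (rule continuous_on_compose2[OF weak_solution_parts(4)[OF sol]])
          (use b \<tau> in \<open>auto intro!: continuous_intros\<close>)
      have Gc: "continuous_on {b..s} (\<lambda>r. blinfun_apply (B r) (adj (B r) (dt u (r - \<tau>))))"
        by (intro continuous_intros continuous_on_subset[OF B sub] dtc)
      have uc: "continuous_on {b..s} (dt u)"
        using weak_solution_parts(4)[OF sol] by (rule continuous_on_subset) (use b in auto)
      have "norm (integral {b..s} (\<lambda>r. blinfun_apply (B r) (adj (B r) (dt u (r - \<tau>))) \<bullet> dt u r))
          \<le> (2 * K * e * y) * (s - b)"
      proof (rule integral_bound)
        show "continuous_on {b..s} (\<lambda>r. blinfun_apply (B r) (adj (B r) (dt u (r - \<tau>))) \<bullet> dt u r)"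
          by (intro continuous_intros Gc uc)
        fix r assume "r \<in> {b..s}"
        hence r: "r \<in> {b..<d}" "r \<in> {b..t}" using s t by auto
        have n: "norm (adj (B r) v) \<le> sqrt K * sqrt 2 * x" if "(norm v)\<^sup>2 \<le> 2 * x\<^sup>2" "0 \<le> x" for v x
        proof -
          have "(norm (adj (B r) v))\<^sup>2 \<le> K * (norm v)\<^sup>2" by (rule upper[OF r(1)])
          also have "\<dots> \<le> K * (2 * x\<^sup>2)" using that K by (intro mult_left_mono)
          finally have "norm (adj (B r) v) \<le> sqrt (K * (2 * x\<^sup>2))" by (rule real_le_rsqrt)
          thus ?thesis using that by (simp add: real_sqrt_mult)
        qed
        have "norm (adj (B r) (dt u (r - \<tau>))) \<le> sqrt K * sqrt 2 * e"
          using past[OF r(1)] e by (intro n) auto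
        moreover have "norm (adj (B r) (dt u r)) \<le> sqrt K * sqrt 2 * y"
          using norm_dt_le_E_S[of u r S] s0(2)[OF r(2)] y by (intro n) auto
        ultimately have "norm (adj (B r) (dt u (r - \<tau>))) * norm (adj (B r) (dt u r)) \<le>
            (sqrt K * sqrt 2 * e) * (sqrt K * sqrt 2 * y)"
          by (rule mult_mono') auto
        also have "\<dots> = (sqrt K * sqrt K) * (sqrt 2 * sqrt 2) * e * y" by (simp only: ac_simps)
        also have "\<dots> = 2 * K * e * y" using K by simp
        finally show "norm (blinfun_apply (B r) (adj (B r) (dt u (r - \<tau>))) \<bullet> dt u r) \<le> 2 * K * e * y"
          using Cauchy_Schwarz_ineq2[of "adj (B r) (dt u (r - \<tau>))" "adj (B r) (dt u r)"]
          by (simp add: inner_adj)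
      qed (use s in auto)
      also have "\<dots> \<le> (2 * K * e * y) * (d - b)" using s t K y e by (intro mult_left_mono) auto
      also have "\<dots> = 2 * \<alpha> * e * y" by (simp add: \<alpha>_def)
      also have "integral {b..s} (\<lambda>r. blinfun_apply (B r) (adj (B r) (dt u (r - \<tau>))) \<bullet> dt u r) =
          E_S S u b - E_S S u s"
        using b s sub F by (intro weak_solution_energy[OF sol _ _ Gc]) auto
      finally show ?thesis by simp
    qed
    have "y\<^sup>2 \<le> e\<^sup>2 + 2 * \<alpha> * e * y" using bound[OF s0(1)] E0 y e by simp
    \<comment> \<open>If y exceeded e (1 + 2 \<alpha>), then also y >= e, and y^2 > e y + 2 \<alpha>
      e y >= e^2 + 2 \<alpha> e y would contradict the quadratic inequality.\<close>
    have ye: "y \<le> e * (1 + 2 * \<alpha>)"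
    proof (rule ccontr)
      assume "\<not> y \<le> e * (1 + 2 * \<alpha>)"
      hence gt: "e * (1 + 2 * \<alpha>) < y" by simp
      moreover have "e * 1 \<le> e * (1 + 2 * \<alpha>)" using \<alpha> e by (intro mult_left_mono) auto
      ultimately have "e \<le> y" "0 < y" using e by auto
      hence "e * e \<le> e * y" "e * (1 + 2 * \<alpha>) * y < y * y" using e gt by (auto intro: mult_left_mono)
      thus False using \<open>y\<^sup>2 \<le> e\<^sup>2 + 2 * \<alpha> * e * y\<close> by (simp add: power2_eq_square algebra_simps)
    qed
    \<comment> \<open>The bound on \<open>y\<close> is inserted into the increment only. The energy
      at \<open>b\<close> itself is kept, so the decay gained on the preceding interval is not
      lost.\<close>
    have "E_S S u t \<le> E_S S u b + 2 * \<alpha> * e * y" using bound[of t] t by auto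
    also have "2 * \<alpha> * e * y \<le> 2 * \<alpha> * e * (e * (1 + 2 * \<alpha>))" using ye \<alpha> e by (intro mult_left_mono) auto
    also have "\<dots> = 2 * \<alpha> * (1 + 2 * \<alpha>) * E0" by (simp add: e(2)[symmetric] power2_eq_square)
    finally show ?thesis by simp
  qed
  show ?thesis
  proof (cases "t < d")
    case False
    have "E_S S u d \<le> E_S S u b + 2 * \<alpha> * (1 + 2 * \<alpha>) * E0"
    proof (rule continuous_on_bound_right[OF _ b(2) open_bound])
      show "continuous_on {b..d} (E_S S u)"
        using continuous_E_S[OF sol] by (rule continuous_on_subset) (use b in auto)
    qed
    thus ?thesis using False t by (simp add: \<alpha>_def)
  qed (use open_bound t in \<open>auto simp: \<alpha>_def\<close>)
qed

end

subsection \<open>Asymptotic stability\<close>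

theorem theorem3p9:
  fixes D V :: "'h::{real_inner, complete_space} set"
    and A S :: "'h \<Rightarrow> 'h"
    and B1 :: "real \<Rightarrow> ('u1::{real_inner, complete_space}) \<Rightarrow>\<^sub>L 'h"
    and B2 :: "real \<Rightarrow> ('u2::{real_inner, complete_space}) \<Rightarrow>\<^sub>L 'h"
    and j1 :: "'h \<Rightarrow> 'w1::{real_inner, complete_space}"
    and j2 :: "'h \<Rightarrow> 'w2::{real_inner, complete_space}"
    and tn m M :: "nat \<Rightarrow> real"
    and \<tau> C1 C2 Tbar :: real
  assumes "selfadjoint_operator D A" and "positive_operator D A" and "has_compact_inverse D A"
    and "is_sqrt_operator V S D A"
    and "continuous_embedding j1 C1" and "continuous_embedding j2 C2"
    and "\<tau> > 0"
    and "tn 0 = 0" and "strict_mono tn"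
    and "\<And>n. slot_len tn (2 * n) \<ge> \<tau>"
    and "\<And>n t. t \<in> slot tn (2 * n) \<Longrightarrow> B2 t = 0"
    and "\<And>n t. t \<in> slot tn (2 * n + 1) \<Longrightarrow> B1 t = 0"
    and "\<And>n. C1_ext (tn (2 * n)) (tn (2 * n + 1)) B1"
    and "\<And>n. C0_ext (tn (2 * n + 1)) (tn (2 * n + 2)) B2"
    and "\<And>n. 0 < m (2 * n)" and "\<And>n. m (2 * n) \<le> M (2 * n)" and "\<And>n. 0 < M (2 * n + 1)"
    and "\<And>n t v. t \<in> slot tn (2 * n) \<Longrightarrow>
           m (2 * n) * (norm (j1 v))\<^sup>2 \<le> (norm (adj (B1 t) v))\<^sup>2"
    and "\<And>n t v. t \<in> slot tn (2 * n) \<Longrightarrow>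
           (norm (adj (B1 t) v))\<^sup>2 \<le> M (2 * n) * (norm (j1 v))\<^sup>2"
    and "\<And>n t v. t \<in> slot tn (2 * n + 1) \<Longrightarrow>
           (norm (adj (B2 t) v))\<^sup>2 \<le> M (2 * n + 1) * (norm (j2 v))\<^sup>2"
    and "\<And>n. slot_len tn (2 * n + 1) \<le> \<tau>"
    and "Tbar > 0"
    and "\<And>T. T > Tbar \<Longrightarrow> observable V S j1 T"
    and "(INF n. slot_len tn (2 * n)) > Tbar"
    and "(INF n. slot_len tn (2 * n)) \<ge> \<tau>"
    and "summable (\<lambda>n. M (2 * n + 1) * slot_len tn (2 * n + 1))"
    and "filterlim (\<lambda>N. \<Sum>n<N. m (2 * n) /
           (1 + 4 * C1\<^sup>2 * (slot_len tn (2 * n))\<^sup>2 * (M (2 * n))\<^sup>2)) at_top sequentially"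
  shows "\<forall>u0\<in>V. \<forall>u1 u. delayed_solution V S B1 B2 \<tau> u0 u1 u \<longrightarrow> (E_S S u \<longlongrightarrow> 0) at_top"
proof (intro ballI allI impI)
  fix u0 u1 u
  assume "u0 \<in> V"
  interpret sqrt_operator D V A S by unfold_locales (rule assms(1-4))+
  define F where "F t = blinfun_apply (B1 t) (adj (B1 t) (dt u t)) +
      blinfun_apply (B2 t) (adj (B2 t) (dt u (t - \<tau>)))" for t
  assume "delayed_solution V S B1 B2 \<tau> u0 u1 u"
  hence sol: "weak_solution V S F u0 u1 u" unfolding delayed_solution_def F_def .
  have mono: "tn k < tn l" if "k < l" for k l using assms(9) that by (rule strict_monoD)
  have monole: "tn k \<le> tn l" if "k \<le> l" for k l
    using assms(9) that by (simp add: strict_mono_less_eq)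
  have tn0: "0 \<le> tn k" for k using monole[of 0 k] assms(8) by simp
  have F_even: "F t = blinfun_apply (B1 t) (adj (B1 t) (dt u t))" if "t \<in> slot tn (2 * n)" for t n
    using assms(11)[OF that] by (simp add: F_def)
  have F_odd: "F t = blinfun_apply (B2 t) (adj (B2 t) (dt u (t - \<tau>)))"
    if "t \<in> slot tn (2 * n + 1)" for t n
    using assms(12)[OF that] by (simp add: F_def)
  have slot_even: "slot tn (2 * n) = {tn (2 * n)..<tn (2 * n + 1)}"
    and slot_odd: "slot tn (2 * n + 1) = {tn (2 * n + 1)..<tn (2 * n + 2)}" for n
    by (simp_all add: slot_def)
  have B1c: "continuous_on (slot tn (2 * n)) B1" and B2c: "continuous_on (slot tn (2 * n + 1)) B2" for n
    unfolding slot_even slot_odd using C1_ext_continuous[OF assms(13)] C0_ext_continuous[OF assms(14)]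
    by auto
  define T where "T n = slot_len tn (2 * n)" for n
  have T: "T n = tn (2 * n + 1) - tn (2 * n)" for n by (simp add: T_def slot_len_def)
  have T\<tau>: "\<tau> \<le> T n" for n unfolding T_def by (rule assms(10))
  define e where "e n = E_S S u (tn (2 * n))" for n
  have e: "0 \<le> e n" for n unfolding e_def by (rule E_S_nonneg)
  have decr: "E_S S u t \<le> E_S S u s" if "tn (2 * n) \<le> s" "s \<le> t" "t \<le> tn (2 * n + 1)" for s t n
    using that F_even[of _ n] B1c[of n] unfolding slot_even
    by (intro damped_energy_decreasing[OF sol tn0]) auto

  define T0 where "T0 = (Tbar + (INF n. slot_len tn (2 * n))) / 2"
  have T0: "Tbar < T0" "0 < T0" using assms(22,24) by (auto simp: T0_def)
  \<comment> \<open>Strictness places the closed observation interval inside the half-open slot,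
    where the bounds and the continuity of \<open>B1\<close> are available.\<close>
  have T0_less: "T0 < T n" for n
  proof -
    have "(INF n. slot_len tn (2 * n)) \<le> T n" unfolding T_def
      using assms(10) by (intro cINF_lower bdd_belowI[of _ \<tau>]) auto
    thus ?thesis using assms(24) by (simp add: T0_def)
  qed
  obtain c where c: "0 < c" and obs: "\<And>w0 w1 w. w0 \<in> V \<Longrightarrow> wave_solution V S w0 w1 w \<Longrightarrow>
      1/2 * ((norm_V S w0)\<^sup>2 + (norm w1)\<^sup>2) \<le> c * integral {0..T0} (\<lambda>s. (norm (j1 (dt w s)))\<^sup>2)"
    using assms(23)[OF T0(1)] unfolding observable_def by blast
  define \<kappa> where "\<kappa> n = 1 / (2 * c) * (m (2 * n) / (1 + 4 * C1\<^sup>2 * (T n)\<^sup>2 * (M (2 * n))\<^sup>2))" for n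
  have even_step: "E_S S u (tn (2 * n + 1)) \<le> (1 - \<kappa> n) * e n" for n
  proof -
    let ?a = "tn (2 * n)" and ?m = "m (2 * n)" and ?M = "M (2 * n)"
    have C1: "0 < C1" using assms(5) by (simp add: continuous_embedding_def)
    have m: "0 < ?m" and M: "?m \<le> ?M" "0 < ?M" using assms(15)[of n] assms(16)[of n] by auto
    have sub: "{?a..?a + T0} \<subseteq> slot tn (2 * n)" using T0_less[of n] by (auto simp: slot_even T)
    define \<Delta> where "\<Delta> = E_S S u ?a - E_S S u (?a + T0)"
    have "e n \<le> 2 * c * (1 / ?m + 4 * C1\<^sup>2 * T0\<^sup>2 * ?M) * \<Delta>"
      unfolding e_def \<Delta>_def
      using F_even sub assms(18,19)
      by (intro damped_observability[OF sol tn0 T0(2) continuous_on_subset[OF B1c sub]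
          _ _ _ m M(2) assms(5) c obs]) auto
    \<comment> \<open>Enlarging \<open>T0\<close> to \<open>T n\<close> and one factor m to M
      produces the reciprocal of \<open>\<kappa> n\<close>; the direction is right because \<Delta>
      >= 0.\<close>
    also have "\<dots> \<le> 2 * c * ((1 + 4 * C1\<^sup>2 * (T n)\<^sup>2 * ?M\<^sup>2) / ?m) * \<Delta>"
    proof (intro mult_right_mono mult_left_mono)
      have "4 * C1\<^sup>2 * T0\<^sup>2 * ?M * ?m \<le> 4 * C1\<^sup>2 * (T n)\<^sup>2 * ?M * ?M"
        using T0 T0_less[of n] m M C1 by (intro mult_mono power_mono mult_nonneg_nonneg) auto
      hence "1 + 4 * C1\<^sup>2 * T0\<^sup>2 * ?M * ?m \<le> 1 + 4 * C1\<^sup>2 * (T n)\<^sup>2 * ?M\<^sup>2"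
        by (simp add: power2_eq_square mult.assoc)
      from divide_right_mono[OF this, of ?m]
      show "1 / ?m + 4 * C1\<^sup>2 * T0\<^sup>2 * ?M \<le> (1 + 4 * C1\<^sup>2 * (T n)\<^sup>2 * ?M\<^sup>2) / ?m"
        using m by (simp add: add_divide_distrib)
      show "0 \<le> \<Delta>" unfolding \<Delta>_def
        using decr[of n ?a "?a + T0"] T0 T0_less[of n] by (auto simp: T)
    qed (use c in auto)
    finally have "\<kappa> n * e n \<le> \<kappa> n * (2 * c * ((1 + 4 * C1\<^sup>2 * (T n)\<^sup>2 * ?M\<^sup>2) / ?m) * \<Delta>)"
      using c m by (intro mult_left_mono) (auto simp: \<kappa>_def)
    also have "\<dots> = \<Delta>"
    proof -
      have "0 < 1 + 4 * C1\<^sup>2 * (T n)\<^sup>2 * ?M\<^sup>2" by (intro add_pos_nonneg) auto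
      thus ?thesis using c m by (simp add: \<kappa>_def)
    qed
    finally have "\<kappa> n * e n \<le> e n - E_S S u (?a + T0)" by (simp add: \<Delta>_def e_def)
    moreover have "E_S S u (tn (2 * n + 1)) \<le> E_S S u (?a + T0)"
      using T0 T0_less[of n] by (intro decr[of n]) (auto simp: T)
    ultimately show ?thesis by (simp add: algebra_simps)
  qed

  define \<alpha> where "\<alpha> n = C2 * (M (2 * n + 1) * slot_len tn (2 * n + 1))" for n
  define b where "b n = 2 * \<alpha> n * (1 + 2 * \<alpha> n)" for n
  have C2: "0 < C2" and jC2: "(norm (j2 v))\<^sup>2 \<le> C2 * (norm v)\<^sup>2" for v
    using assms(6) by (auto simp: continuous_embedding_def)
  have \<alpha>: "0 \<le> \<alpha> n" for n
    unfolding \<alpha>_def slot_len_def using C2 assms(17)[of n] mono[of "2 * n + 1" "Suc (2 * n + 1)"] by simp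
  have b0: "0 \<le> b n" for n using \<alpha>[of n] by (simp add: b_def)
  have odd_step: "E_S S u t \<le> E_S S u (tn (2 * n + 1)) + b n * e n"
    if t: "t \<in> {tn (2 * n + 1)..tn (2 * n + 2)}" for t n
  proof -
    \<comment> \<open>An even slot lasts at least \<tau> and an odd one at most \<tau>, so a time of
      the odd slot shifted back by \<tau> falls into the preceding even slot, where the energy is at
      most \<open>e n\<close>.\<close>
    have "\<tau> \<le> tn (2 * n + 1) - tn (2 * n)" using T\<tau>[of n] by (simp add: T)
    hence after: "tn (2 * n) \<le> tn (2 * n + 1) - \<tau>" by simp
    have len: "tn (2 * n + 2) - tn (2 * n + 1) \<le> \<tau>" using assms(21)[of n] by (simp add: slot_len_def)
    have "E_S S u t \<le> E_S S u (tn (2 * n + 1)) +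
        2 * (M (2 * n + 1) * C2 * (tn (2 * n + 2) - tn (2 * n + 1))) *
        (1 + 2 * (M (2 * n + 1) * C2 * (tn (2 * n + 2) - tn (2 * n + 1)))) * e n"
    proof (rule delayed_energy_growth[OF sol tn0 mono _ _ _ _ _ _ _ t])
      show "0 \<le> tn (2 * n + 1) - \<tau>" using after tn0[of "2 * n"] by linarith
      show "continuous_on {tn (2 * n + 1)..<tn (2 * n + 2)} B2" using B2c[of n] unfolding slot_odd .
      show "E_S S u (tn (2 * n + 1)) \<le> e n"
        unfolding e_def using monole[of "2 * n" "2 * n + 1"] by (intro decr[of n]) auto
      fix r assume r: "r \<in> {tn (2 * n + 1)..<tn (2 * n + 2)}"
      show "F r = blinfun_apply (B2 r) (adj (B2 r) (dt u (r - \<tau>)))"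
        using F_odd r unfolding slot_odd by blast
      have "E_S S u (r - \<tau>) \<le> e n"
        unfolding e_def using r after len by (intro decr[of n]) auto
      thus "(norm (dt u (r - \<tau>)))\<^sup>2 \<le> 2 * e n" using norm_dt_le_E_S[of u "r - \<tau>" S] by linarith
      fix v
      have "(norm (adj (B2 r) v))\<^sup>2 \<le> M (2 * n + 1) * (norm (j2 v))\<^sup>2"
        using assms(20) r unfolding slot_odd by blast
      also have "\<dots> \<le> M (2 * n + 1) * (C2 * (norm v)\<^sup>2)"
        using jC2 assms(17)[of n] by (intro mult_left_mono) auto
      finally show "(norm (adj (B2 r) v))\<^sup>2 \<le> M (2 * n + 1) * C2 * (norm v)\<^sup>2" by simp
    qed (use C2 assms(17)[of n] in auto)
    thus ?thesis by (simp add: b_def \<alpha>_def slot_len_def ac_simps)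
  qed
  have step: "e (Suc n) \<le> e n * (1 - \<kappa> n + b n)" for n
    using odd_step[of "tn (2 * n + 2)" n] even_step[of n] monole[of "2 * n + 1" "2 * n + 2"]
    by (simp add: e_def algebra_simps)
  have "summable \<alpha>" unfolding \<alpha>_def by (intro summable_mult assms(26))
  obtain K where K: "\<And>n. \<alpha> n \<le> K"
    using Bseq_bdd_above[OF summable_imp_Bseq[OF \<open>summable \<alpha>\<close>]] unfolding bdd_above_def by auto
  \<comment> \<open>As a summable sequence \<alpha> is bounded, so the quadratic term of
    \<open>b\<close> is dominated by a multiple of \<alpha>.\<close>
  have bK: "b n \<le> 2 * (1 + 2 * K) * \<alpha> n" for n
  proof -
    have "\<alpha> n * (1 + 2 * \<alpha> n) \<le> \<alpha> n * (1 + 2 * K)" using \<alpha> K by (intro mult_left_mono) auto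
    thus ?thesis by (simp add: b_def algebra_simps)
  qed
  have "summable b"
    by (rule summable_comparison_test'[OF summable_mult[OF \<open>summable \<alpha>\<close>, of "2 * (1 + 2 * K)"], of 0])
      (use bK b0 in simp)
  moreover have "filterlim (\<lambda>N. 1 / (2 * c) * (\<Sum>n<N. m (2 * n) /
      (1 + 4 * C1\<^sup>2 * (slot_len tn (2 * n))\<^sup>2 * (M (2 * n))\<^sup>2))) at_top sequentially"
    using c by (intro filterlim_tendsto_pos_mult_at_top[OF tendsto_const _ assms(27)]) auto
  hence "filterlim (\<lambda>N. \<Sum>n<N. \<kappa> n) at_top sequentially"
    by (simp add: \<kappa>_def T_def sum_distrib_left)
  ultimately have lim: "e \<longlonglongrightarrow> 0" using e step by (intro perturbed_decay_tendsto_0)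

  \<comment> \<open>So far only the times \<open>tn (2 * n)\<close> are covered. A uniform factor
    \<open>L\<close> over each even-odd cycle extends the limit to all times.\<close>
  define L where "L = 1 + 2 * (1 + 2 * K) * K"
  have L: "1 + b n \<le> L" for n
  proof -
    have "2 * (1 + 2 * K) * \<alpha> n \<le> 2 * (1 + 2 * K) * K"
      using K[of n] \<alpha>[of n] by (intro mult_left_mono) auto
    thus ?thesis using bK[of n] by (simp add: L_def)
  qed
  have cycle: "E_S S u t \<le> L * e n" if t: "t \<in> {tn (2 * n)..tn (2 * n + 2)}" for t n
  proof -
    have "E_S S u t \<le> (1 + b n) * e n"
    proof (cases "t \<le> tn (2 * n + 1)")
      case True
      hence "E_S S u t \<le> e n" unfolding e_def using t by (intro decr[of n]) auto
      thus ?thesis using b0[of n] e[of n] by (simp add: distrib_right add_increasing2)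
    next
      case False
      have "E_S S u (tn (2 * n + 1)) \<le> e n"
        unfolding e_def using monole[of "2 * n" "2 * n + 1"] by (intro decr[of n]) auto
      thus ?thesis using odd_step[of t n] False t by (simp add: distrib_right)
    qed
    also have "\<dots> \<le> L * e n" using L e by (intro mult_right_mono)
    finally show ?thesis .
  qed
  \<comment> \<open>The switching times exhaust the half-line, so every time belongs to some
    cycle.\<close>
  have grow: "real n * \<tau> \<le> tn (2 * n)" for n
  proof (induction n)
    case (Suc n)
    have "tn (2 * n) + \<tau> \<le> tn (2 * Suc n)"
      using T\<tau>[of n] monole[of "2 * n + 1" "2 * Suc n"] by (simp add: T)
    thus ?case using Suc by (simp add: algebra_simps)
  qed (simp add: tn0)
  show "(E_S S u \<longlongrightarrow> 0) at_top"
  proof (rule tendstoI)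
    fix \<epsilon> :: real assume \<epsilon>: "0 < \<epsilon>"
    have "(\<lambda>n. L * e n) \<longlonglongrightarrow> L * 0" by (intro tendsto_mult_left lim)
    hence "eventually (\<lambda>n. L * e n < \<epsilon>) sequentially" using \<epsilon> by (auto dest: order_tendstoD(2))
    then obtain N where N: "\<And>n. n \<ge> N \<Longrightarrow> L * e n < \<epsilon>" unfolding eventually_sequentially by blast
    have "dist (E_S S u t) 0 < \<epsilon>" if t: "tn (2 * N) \<le> t" for t
    proof -
      obtain k where k: "t / \<tau> < real k" using reals_Archimedean2 by blast
      hence "t < tn (2 * k)" using grow[of k] assms(7) by (simp add: field_simps)
      \<comment> \<open>The least even switching time beyond t ends the cycle containing t. Since
        \<open>N < l\<close>, its predecessor \<open>n\<close> exists and is at least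
        \<open>N\<close>.\<close>
      define l where "l = (LEAST l. t < tn (2 * l))"
      have l: "t < tn (2 * l)" unfolding l_def using \<open>t < tn (2 * k)\<close> by (rule LeastI)
      have "N < l"
      proof (rule ccontr)
        assume "\<not> N < l"
        hence "tn (2 * l) \<le> tn (2 * N)" by (intro monole) simp
        thus False using l t by linarith
      qed
      then obtain n where n: "l = Suc n" "N \<le> n" by (cases l) auto
      have "\<not> t < tn (2 * n)" using not_less_Least[of n "\<lambda>l. t < tn (2 * l)"] n(1) by (simp add: l_def)
      hence "E_S S u t \<le> L * e n" using l n(1) by (intro cycle) auto
      thus ?thesis using N[OF n(2)] E_S_nonneg[of S u t] by simp
    qed
    thus "eventually (\<lambda>t. dist (E_S S u t) 0 < \<epsilon>) at_top" by (auto simp: eventually_at_top_linorder)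
  qed
qed

end
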